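(* Let $p$ be an odd prime and $n\ge1$. Let $b_0,\dots,b_n$ be integers with $b_n=0$, $b_{n-1}=1$, $b_k\ge1$ for $k<n$, and $b_{k+1}+1\ge b_k$ for $0\le k\le n-1$ (i.e. $k\mapsto b_k+k$ is non-decreasing). Fix a generator $x$ of $G=\mu_{p^n}$ and an integer $\alpha$ whose class generates $(\mathbb{Z}/p^n\mathbb{Z})^\times$. Put $u_k=\phi(p^{b_k})$, $\beta_k=\alpha^{u_k}$, and for $0\le k\le n$ and $i\in\mathbb{Z}/u_k\mathbb{Z}$, $$A_{i,k}=\{x^{p^k\alpha^i\beta_k^t}\mid t=0,1,\dots,p^{n-k-b_k}-1\}.$$ Let $\mathcal{P}_k=\{A_{i,k}\mid i\in\mathbb{Z}/u_k\mathbb{Z}\}$ and $\mathcal{P}=\bigsqcup_{k=0}^n\mathcal{P}_k$. Then $\mathcal{P}$ is a fusion partition of $G$ satisfying condition (p), and every fusion partition of $\mu_{p^n}$ satisfying condition (p) is obtained in this way.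
   Context: A unital partition of a finite commutative group $G$ is a partition $G=\{1\}\sqcup A_0\sqcup\dots\sqcup A_s$ such that, with $a_i=\sum_{x\in A_i}x\in\mathbb{Z}[G]$, the $\mathbb{Z}$-span of $1$ and the $a_i$ is closed under multiplication in $\mathbb{Z}[G]$. It is a fusion partition if moreover (1) for each member $A_i$ the set $\{x^{-1}:x\in A_i\}$ is a member, denoted $A_{i^*}$, and (2) writing $a_ia_j=\sum_kn^k_{i,j}a_k$ (over all members, including $\{1\}$), one has $n^k_{i,j}|A_k|=n^{j^*}_{i,k^*}|A_{j^*}|$ for all $i,j,k$. Condition (p): every member of the partition has cardinality a power of $p$. $\phi$ is Euler's function. *)

theory Defs
  imports Complex_Main "HOL-Library.Indicator_Function" "HOL-Number_Theory.Number_Theory"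
begin

definition mu :: "nat \<Rightarrow> complex set" where
  "mu m = {z. z ^ m = 1}"

text \<open>Multiplication in the group ring Z[G]; elements of Z[G] are integer-valued
  functions supported on G.\<close>
definition gconv :: "complex set \<Rightarrow> (complex \<Rightarrow> int) \<Rightarrow> (complex \<Rightarrow> int) \<Rightarrow> complex \<Rightarrow> int" where
  "gconv G f g z = (\<Sum>(a, b) \<in> {(a, b). a \<in> G \<and> b \<in> G \<and> a * b = z}. f a * g b)"

definition set_partition_of :: "complex set \<Rightarrow> complex set set \<Rightarrow> bool" where
  "set_partition_of G P \<longleftrightarrow>
     (\<forall>A\<in>P. A \<noteq> {} \<and> A \<subseteq> G) \<and> (\<forall>A\<in>P. \<forall>B\<in>P. A \<noteq> B \<longrightarrow> A \<inter> B = {}) \<and> \<Union>P = G"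

definition in_zspan :: "complex set set \<Rightarrow> (complex \<Rightarrow> int) \<Rightarrow> bool" where
  "in_zspan P f \<longleftrightarrow> (\<exists>c :: complex set \<Rightarrow> int. \<forall>z. f z = (\<Sum>A\<in>P. c A * indicator A z))"

definition unital_partition :: "complex set \<Rightarrow> complex set set \<Rightarrow> bool" where
  "unital_partition G P \<longleftrightarrow> set_partition_of G P \<and> {1} \<in> P \<and>
     (\<forall>A\<in>P. \<forall>B\<in>P. in_zspan P (gconv G (indicator A) (indicator B)))"

definition struct_coeffs :: "complex set \<Rightarrow> complex set set \<Rightarrow> complex set \<Rightarrow> complex set \<Rightarrow> (complex set \<Rightarrow> int) \<Rightarrow> bool" where
  "struct_coeffs G P A B c \<longleftrightarrow> (\<forall>z. gconv G (indicator A) (indicator B) z = (\<Sum>D\<in>P. c D * indicator D z))"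

definition fusion_partition :: "complex set \<Rightarrow> complex set set \<Rightarrow> bool" where
  "fusion_partition G P \<longleftrightarrow> unital_partition G P \<and>
     (\<forall>A\<in>P. inverse ` A \<in> P) \<and>
     (\<forall>A\<in>P. \<forall>B\<in>P. \<forall>C\<in>P. \<forall>c e. struct_coeffs G P A B c \<and> struct_coeffs G P A (inverse ` C) e \<longrightarrow>
        c C * int (card C) = e (inverse ` B) * int (card (inverse ` B)))"

definition cond_p :: "nat \<Rightarrow> complex set set \<Rightarrow> bool" where
  "cond_p p P \<longleftrightarrow> (\<forall>A\<in>P. \<exists>e. card A = p ^ e)"

definition admissible_b :: "nat \<Rightarrow> (nat \<Rightarrow> nat) \<Rightarrow> bool" where
  "admissible_b n b \<longleftrightarrow> b n = 0 \<and> b (n - 1) = 1 \<and> (\<forall>k<n. 1 \<le> b k) \<and> (\<forall>k<n. b k \<le> b (Suc k) + 1)"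

definition is_generator :: "nat \<Rightarrow> complex \<Rightarrow> bool" where
  "is_generator m x \<longleftrightarrow> x \<in> mu m \<and> (\<forall>z\<in>mu m. \<exists>j::nat. z = x ^ j)"

definition unit_generator :: "nat \<Rightarrow> int \<Rightarrow> bool" where
  "unit_generator m \<alpha> \<longleftrightarrow> coprime \<alpha> (int m) \<and>
     (\<forall>y::int. coprime y (int m) \<longrightarrow> (\<exists>j::nat. [\<alpha> ^ j = y] (mod int m)))"

definition A_set :: "nat \<Rightarrow> nat \<Rightarrow> (nat \<Rightarrow> nat) \<Rightarrow> complex \<Rightarrow> int \<Rightarrow> nat \<Rightarrow> nat \<Rightarrow> complex set" where
  "A_set p n b x \<alpha> i k =
     {x powi (int (p ^ k) * \<alpha> ^ i * (\<alpha> ^ totient (p ^ b k)) ^ t) | t. t < p ^ (n - k - b k)}"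

definition fusion_family :: "nat \<Rightarrow> nat \<Rightarrow> (nat \<Rightarrow> nat) \<Rightarrow> complex \<Rightarrow> int \<Rightarrow> complex set set" where
  "fusion_family p n b x \<alpha> = {A_set p n b x \<alpha> i k | i k. k \<le> n \<and> i < totient (p ^ b k)}"

end

(*
In terms of subgroups, A_{i,k} is the coset x^(p^k alpha^i) H of the subgroup H of order
p^(n-k-b_k), and the condition on b says that these subgroups shrink as the level k grows.
Products of such cosets are then unions of members.

Conversely, the number of ways to write z as a product of q elements of a member A is constant on
members; for a prime q not equal to p it is congruent modulo q to the number of a in A with
a^q = z, because q-tuples may be rotated. Hence raising to a power prime to p permutes the members.
As card A is a power of p, the stabiliser of A <> {1} in the group of units is a p-group, so A has
phi(p^b) conjugates for some b >= 1. Their union T is stable under all units and has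
(p - 1) p^j elements for some j; comparing sizes shows that T is a single level, so A is an orbit
of the stabiliser, which is a coset. Members of the same level are conjugate, hence share b, and
the p-th power of a member of level k bounds the member of level k + 1.
*)
theory Submission
  imports Defs
begin

section \<open>Products of partition members and tuples\<close>

text \<open>The congruence modulo q is that of Schur's theorem on multipliers: in Z[G] modulo q, the
  q-th power of the sum of a set is the sum of the q-th powers of its elements. It speaks of prime
  exponents only, and it shows only that the image of a member is a union of members. Unions of
  members are therefore what is followed through the factorisation of an exponent; applying an
  inverse exponent finally shows that the image is one member. The exponent p is not invertible and
  escapes this argument, so neighbouring levels are related through p-fold products instead. Because
  the units modulo p^n are the powers of one g, the stabiliser of a member is recorded by a single
  period u, which is also its number of conjugates. Once the index phi(p^n)/u is known to be a power
  p^s, the shape u = phi(p^b) follows with b = n - s. Computations with elements of G take place in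
  the exponents of x: a coset is a residue class modulo p^c, and the level of an element is the
  p-adic valuation of its exponent, cut off at n.\<close>

lemma card_cong_card_fixed_points:
  fixes f :: "'a \<Rightarrow> 'a"
  assumes fin: "finite X" and q: "prime (q::nat)" and fX: "f ` X \<subseteq> X"
    and per: "\<And>x. x \<in> X \<Longrightarrow> (f ^^ q) x = x"
  shows "[card X = card {x \<in> X. f x = x}] (mod q)"
proof -
  define orb where "orb x = (\<lambda>i. (f ^^ i) x) ` {..<q}" for x
  let ?Y = "{x \<in> X. f x \<noteq> x}"
  have q0: "q > 0" using q by (simp add: prime_gt_0_nat)
  have inX: "(f ^^ i) x \<in> X" if "x \<in> X" for i x
    by (induction i) (use that fX in auto)
  have perq: "(f ^^ (q * t)) x = x" if "x \<in> X" for t x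
    by (induction t) (use that per in \<open>auto simp: funpow_add\<close>)
  have modq: "(f ^^ i) x = (f ^^ (i mod q)) x" if "x \<in> X" for i x
  proof -
    have "(f ^^ (i mod q + q * (i div q))) x = (f ^^ (i mod q)) x"
      by (simp only: funpow_add o_apply perq[OF that])
    thus ?thesis by simp
  qed
  \<comment> \<open>Primality of q enters here: a return time d strictly between 0 and q is
    invertible modulo q, so returning after d steps means being fixed by f. Hence the orbit of a
    moved point has exactly q elements.\<close>
  have fix1: "f x = x" if x: "x \<in> X" and d: "(f ^^ d) x = x" "0 < d" "d < q" for x d
  proof -
    have "coprime d q"
      using q d by (metis coprime_commute nat_dvd_not_less prime_imp_coprime_nat)
    then obtain e where e: "[d * e = 1] (mod q)" using cong_solve_coprime_nat by auto
    have "(f ^^ (d * e)) x = x" by (induction e) (use d in \<open>auto simp: funpow_add\<close>)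
    moreover have "(d * e) mod q = 1" using e prime_gt_1_nat[OF q] by (simp add: cong_def)
    ultimately show ?thesis using modq[OF x, of "d * e"] by simp
  qed
  have inj: "inj_on (\<lambda>i. (f ^^ i) x) {..<q}" if x: "x \<in> ?Y" for x
  proof (rule linorder_inj_onI)
    fix i j assume ij: "i < j" "i \<in> {..<q}" "j \<in> {..<q}"
    show "(f ^^ i) x \<noteq> (f ^^ j) x"
    proof
      assume eq: "(f ^^ i) x = (f ^^ j) x"
      have "x = (f ^^ ((q - i) + i)) x" using per x ij by auto
      also have "\<dots> = (f ^^ ((q - i) + j)) x" by (simp only: funpow_add o_apply eq)
      also have "(q - i) + j = (j - i) + q" using ij by auto
      also have "(f ^^ ((j - i) + q)) x = (f ^^ (j - i)) x" using x per by (simp add: funpow_add)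
      finally have "(f ^^ (j - i)) x = x" by simp
      moreover have "0 < j - i" "j - i < q" using ij by auto
      ultimately show False using fix1[of x "j - i"] x by simp
    qed
  qed auto
  have orb_sub: "orb x \<subseteq> ?Y" if x: "x \<in> ?Y" for x
  proof
    fix y assume "y \<in> orb x"
    then obtain i where i: "i < q" "y = (f ^^ i) x" by (auto simp: orb_def)
    have "f y \<noteq> y"
    proof
      assume "f y = y"
      hence "(f ^^ t) y = y" for t by (induction t) auto
      hence "y = (f ^^ (q - i + i)) x" using i by (simp only: funpow_add o_apply)
      hence "y = x" using per x i by auto
      thus False using \<open>f y = y\<close> x by auto
    qed
    thus "y \<in> ?Y" using inX x i by auto
  qed
  have orb_eq: "orb y \<subseteq> orb x" if x: "x \<in> ?Y" and y: "y \<in> orb x" for x y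
  proof
    fix z assume "z \<in> orb y"
    then obtain i j where "z = (f ^^ i) ((f ^^ j) x)" using y by (auto simp: orb_def)
    hence "z = (f ^^ (i + j)) x" by (simp add: funpow_add)
    hence "z = (f ^^ ((i + j) mod q)) x" using modq[of x "i + j"] x by simp
    thus "z \<in> orb x" using q0 by (auto simp: orb_def)
  qed
  have orb_sym: "x \<in> orb y" if x: "x \<in> ?Y" and y: "y \<in> orb x" for x y
  proof -
    obtain i where i: "i < q" "y = (f ^^ i) x" using y by (auto simp: orb_def)
    have "x = (f ^^ (q - i + i)) x" using per x i by auto
    hence "x = (f ^^ (q - i)) y" using i by (simp only: funpow_add o_apply)
    moreover have "y \<in> X" using i inX x by auto
    ultimately have "x = (f ^^ ((q - i) mod q)) y" using modq by metis
    thus ?thesis using q0 by (auto simp: orb_def)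
  qed
  have self: "x \<in> orb x" for x using q0 by (force simp: orb_def)
  have Un: "\<Union> (orb ` ?Y) = ?Y" using orb_sub self by blast
  have "q dvd card (\<Union> (orb ` ?Y))"
  proof (rule dvd_partition)
    show "finite (\<Union> (orb ` ?Y))" unfolding Un using fin by auto
    show "\<forall>c\<in>orb ` ?Y. q dvd card c" using inj by (auto simp: orb_def card_image)
    show "\<forall>c1\<in>orb ` ?Y. \<forall>c2\<in>orb ` ?Y. c1 \<noteq> c2 \<longrightarrow> c1 \<inter> c2 = {}"
    proof (intro ballI impI)
      fix c1 c2 assume c: "c1 \<in> orb ` ?Y" "c2 \<in> orb ` ?Y" "c1 \<noteq> c2"
      then obtain x y where xy: "x \<in> ?Y" "y \<in> ?Y" "c1 = orb x" "c2 = orb y" by auto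
      show "c1 \<inter> c2 = {}"
      proof (rule ccontr)
        assume "c1 \<inter> c2 \<noteq> {}"
        then obtain z where z: "z \<in> orb x" "z \<in> orb y" using xy by auto
        have zY: "z \<in> ?Y" using orb_sub xy z by blast
        have "orb x = orb z" "orb y = orb z"
          using orb_eq orb_sym xy z zY by blast+
        thus False using c xy by simp
      qed
    qed
  qed
  hence "q dvd card ?Y" using Un by simp
  moreover have "card X = card ?Y + card {x \<in> X. f x = x}"
    using fin by (subst card_Un_disjoint[symmetric]) (auto intro: arg_cong[where f = card])
  ultimately show ?thesis by (simp add: cong_def mod_add_left_eq[symmetric])
qed

section \<open>Roots of unity and convolution in the group ring\<close>

lemma finite_mu: "N > 0 \<Longrightarrow> finite (mu N)"
  unfolding mu_def by (rule finite_roots_unity) auto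

lemma card_mu: "N > 0 \<Longrightarrow> card (mu N) = N"
  unfolding mu_def by (rule card_roots_unity_eq)

lemma one_in_mu [simp]: "1 \<in> mu N"
  by (simp add: mu_def)

lemma mu_mult: "a \<in> mu N \<Longrightarrow> b \<in> mu N \<Longrightarrow> a * b \<in> mu N"
  by (simp add: mu_def power_mult_distrib)

lemma mu_divide: "a \<in> mu N \<Longrightarrow> b \<in> mu N \<Longrightarrow> a / b \<in> mu N"
  by (simp add: mu_def power_divide)

lemma mu_power: "a \<in> mu N \<Longrightarrow> a ^ k \<in> mu N"
  by (simp add: mu_def) (metis mult.commute power_mult power_one)

lemma mu_nonzero: "N > 0 \<Longrightarrow> a \<in> mu N \<Longrightarrow> a \<noteq> 0"
  by (auto simp: mu_def power_0_left)

text \<open>In a group the factor a determines b = z / a, so the sum over pairs becomes a sum over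
  A. For z outside the group there are no pairs at all, whence the value 0.\<close>

lemma gconv_indicator:
  assumes N: "N > 0" and A: "A \<subseteq> mu N"
  shows "gconv (mu N) (indicator A) f z = (if z \<in> mu N then \<Sum>a\<in>A. f (z / a) else 0)"
proof (cases "z \<in> mu N")
  case False
  hence "{(a, b). a \<in> mu N \<and> b \<in> mu N \<and> a * b = z} = {}" using mu_mult by blast
  thus ?thesis using False unfolding gconv_def by (simp only: sum.empty if_False)
next
  case True
  have "gconv (mu N) (indicator A) f z = (\<Sum>a\<in>mu N. indicator A a * f (z / a))"
    unfolding gconv_def
  proof (rule sum.reindex_bij_witness[where i = "\<lambda>a. (a, z / a)" and j = fst])
    fix ab assume "ab \<in> {(a, b). a \<in> mu N \<and> b \<in> mu N \<and> a * b = z}"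
    then obtain a b where ab: "ab = (a, b)" "a \<in> mu N" "b \<in> mu N" "a * b = z" by auto
    hence "b = z / a" using mu_nonzero[OF N ab(2)] by (simp add: field_simps)
    thus "(fst ab, z / fst ab) = ab" "fst ab \<in> mu N"
      "indicator A (fst ab) * f (z / fst ab) = (case ab of (a, b) \<Rightarrow> indicator A a * f b)"
      using ab by simp_all
  next
    fix a assume a: "a \<in> mu N"
    thus "(a, z / a) \<in> {(a, b). a \<in> mu N \<and> b \<in> mu N \<and> a * b = z}"
      using mu_nonzero[OF N a] mu_divide[OF True a] by simp
  qed simp
  also have "\<dots> = (\<Sum>a\<in>A. f (z / a))"
    by (rule sum.mono_neutral_cong_right) (use A finite_mu[OF N] in \<open>auto simp: indicator_def\<close>)
  finally show ?thesis using True by simp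
qed

text \<open>The span of the member sums described without coefficients, which is the form that
  counting arguments produce; \<open>in_zspan_iff\<close> identifies the two.\<close>

definition class_function :: "complex set set \<Rightarrow> (complex \<Rightarrow> int) \<Rightarrow> bool" where
  "class_function P f \<longleftrightarrow>
     (\<forall>D\<in>P. \<forall>z\<in>D. \<forall>w\<in>D. f z = f w) \<and> (\<forall>z. z \<notin> \<Union>P \<longrightarrow> f z = 0)"

lemma partition_finite:
  assumes "set_partition_of G P" "finite G"
  shows "finite P" "A \<in> P \<Longrightarrow> finite A"
  using assms finite_UnionD[of P] by (auto simp: set_partition_of_def intro: finite_subset)

lemma partition_sum_indicator:
  fixes c :: "complex set \<Rightarrow> int"
  assumes P: "set_partition_of G P" "finite G"
  shows "C \<in> P \<Longrightarrow> z \<in> C \<Longrightarrow> (\<Sum>D\<in>P. c D * indicator D z) = c C"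
    and "z \<notin> G \<Longrightarrow> (\<Sum>D\<in>P. c D * indicator D z) = 0"
proof -
  assume C: "C \<in> P" "z \<in> C"
  have "(\<Sum>D\<in>P. c D * indicator D z) = (\<Sum>D\<in>P. if D = C then c C else 0)"
    by (rule sum.cong) (use P C in \<open>auto simp: set_partition_of_def indicator_def\<close>)
  thus "(\<Sum>D\<in>P. c D * indicator D z) = c C" using partition_finite[OF P] C by simp
next
  assume "z \<notin> G"
  thus "(\<Sum>D\<in>P. c D * indicator D z) = 0"
    using P by (intro sum.neutral) (auto simp: set_partition_of_def indicator_def)
qed

lemma in_zspan_iff:
  assumes P: "set_partition_of G P" "finite G"
  shows "in_zspan P f \<longleftrightarrow> class_function P f"
proof
  have U: "\<Union>P = G" using P by (simp add: set_partition_of_def)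
  {
    assume "in_zspan P f"
    then obtain c where c: "\<And>z. f z = (\<Sum>A\<in>P. c A * indicator A z)"
      by (auto simp: in_zspan_def)
    show "class_function P f"
      unfolding class_function_def U c using partition_sum_indicator[OF P] by simp
  next
    assume f: "class_function P f"
    define c where "c A = f (SOME z. z \<in> A)" for A
    have "f z = (\<Sum>A\<in>P. c A * indicator A z)" for z
    proof (cases "z \<in> G")
      case True
      then obtain C where C: "C \<in> P" "z \<in> C" using U by auto
      hence "f z = c C" using f unfolding c_def class_function_def by (metis someI)
      thus ?thesis using partition_sum_indicator[OF P] C by simp
    next
      case False
      thus ?thesis using partition_sum_indicator[OF P] f U by (simp add: class_function_def)
    qed
    thus "in_zspan P f" by (auto simp: in_zspan_def)
  }
qed

text \<open>Closure under multiplication is postulated for pairs of members; linearity in the second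
  factor extends it to the whole span, which makes induction on the number of factors
  possible.\<close>

lemma class_function_gconv:
  assumes N: "N > 0" and P: "unital_partition (mu N) P" and A: "A \<in> P"
    and f: "class_function P f"
  shows "class_function P (gconv (mu N) (indicator A) f)"
proof -
  note fin = finite_mu[OF N]
  have part: "set_partition_of (mu N) P" using P by (simp add: unital_partition_def)
  have AG: "A \<subseteq> mu N" using part A by (simp add: set_partition_of_def)
  obtain c where c: "\<And>z. f z = (\<Sum>D\<in>P. c D * indicator D z)"
    using f in_zspan_iff[OF part fin] by (auto simp: in_zspan_def)
  have eq: "gconv (mu N) (indicator A) f z =
      (\<Sum>D\<in>P. c D * gconv (mu N) (indicator A) (indicator D) z)" for z
    unfolding gconv_indicator[OF N AG] c
    by (auto simp: sum_distrib_left intro: sum.swap)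
  have D: "class_function P (gconv (mu N) (indicator A) (indicator D))" if "D \<in> P" for D
    using P A that in_zspan_iff[OF part fin] by (auto simp: unital_partition_def)
  show ?thesis
    unfolding class_function_def eq
  proof (intro conjI ballI allI impI)
    fix C z w assume "C \<in> P" "z \<in> C" "w \<in> C"
    thus "(\<Sum>D\<in>P. c D * gconv (mu N) (indicator A) (indicator D) z) =
        (\<Sum>D\<in>P. c D * gconv (mu N) (indicator A) (indicator D) w)"
      using D unfolding class_function_def by (intro sum.cong refl arg_cong2[where f = times]) blast
  next
    fix z assume "z \<notin> \<Union>P"
    thus "(\<Sum>D\<in>P. c D * gconv (mu N) (indicator A) (indicator D) z) = 0"
      using D by (intro sum.neutral) (simp add: class_function_def)
  qed
qed

section \<open>Powers of a member sum, counted by lists\<close>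

definition tuples :: "complex set \<Rightarrow> nat \<Rightarrow> complex \<Rightarrow> complex list set" where
  "tuples A k z = {xs. length xs = k \<and> set xs \<subseteq> A \<and> prod_list xs = z}"

lemma finite_tuples: "finite A \<Longrightarrow> finite (tuples A k z)"
  unfolding tuples_def by (rule finite_subset[OF _ finite_lists_length_eq[of A k]]) auto

lemma card_tuples_Suc:
  assumes "finite A" "0 \<notin> A"
  shows "card (tuples A (Suc k) z) = (\<Sum>a\<in>A. card (tuples A k (z / a)))"
proof -
  have "tuples A (Suc k) z = (\<Union>a\<in>A. (#) a ` tuples A k (z / a))"
  proof (intro equalityI subsetI)
    fix xs assume "xs \<in> tuples A (Suc k) z"
    then obtain a ys where "xs = a # ys" "a \<in> A" "length ys = k" "set ys \<subseteq> A" "a * prod_list ys = z"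
      by (auto simp: tuples_def length_Suc_conv)
    moreover from this have "a \<noteq> 0" using assms by auto
    ultimately have "xs = a # ys" "a \<in> A" "ys \<in> tuples A k (z / a)"
      by (auto simp: tuples_def)
    thus "xs \<in> (\<Union>a\<in>A. (#) a ` tuples A k (z / a))" by blast
  next
    fix xs assume "xs \<in> (\<Union>a\<in>A. (#) a ` tuples A k (z / a))"
    then obtain a ys where "xs = a # ys" "a \<in> A" "ys \<in> tuples A k (z / a)" by auto
    moreover from this have "a \<noteq> 0" using assms by auto
    ultimately show "xs \<in> tuples A (Suc k) z" by (auto simp: tuples_def)
  qed
  also have "card \<dots> = (\<Sum>a\<in>A. card ((#) a ` tuples A k (z / a)))"
    using assms by (intro card_UN_disjoint) (auto simp: finite_tuples)
  also have "\<dots> = (\<Sum>a\<in>A. card (tuples A k (z / a)))"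
    by (simp add: card_image)
  finally show ?thesis .
qed

text \<open>The count is the coefficient of z in the k-th power of the sum of A. The empty product
  gives the indicator of the member {1}, and each further factor is a convolution with the indicator
  of A.\<close>

lemma class_function_tuples:
  assumes N: "N > 0" and P: "unital_partition (mu N) P" and A: "A \<in> P"
  shows "class_function P (\<lambda>z. int (card (tuples A k z)))"
proof (induction k)
  case 0
  have "tuples A 0 z = (if z = 1 then {[]} else {})" for z by (auto simp: tuples_def)
  hence "(\<lambda>z. int (card (tuples A 0 z))) = indicator {1}"
    by (auto simp: indicator_def fun_eq_iff)
  moreover have "class_function P (indicator {1})"
    unfolding class_function_def
  proof (intro conjI ballI allI impI)
    have one: "{1} \<in> P" using P by (simp add: unital_partition_def)
    fix C z w assume C: "C \<in> P" "z \<in> C" "w \<in> C"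
    show "(indicator {1} z :: int) = indicator {1} w"
    proof (cases "C = {1}")
      case False
      hence "C \<inter> {1} = {}"
        using P one C by (auto simp: unital_partition_def set_partition_of_def)
      thus ?thesis using C by (auto simp: indicator_def)
    qed (use C in auto)
  next
    fix z assume "z \<notin> \<Union>P"
    thus "(indicator {1} z :: int) = 0"
      using P by (auto simp: unital_partition_def indicator_def)
  qed
  ultimately show ?case by simp
next
  case (Suc k)
  have AG: "A \<subseteq> mu N" using P A by (simp add: unital_partition_def set_partition_of_def)
  \<comment> \<open>\<open>gconv\<close> vanishes outside the group, so the count has to vanish
    there too for the identity below to hold at every w.\<close>
  have z: "tuples A j z = {}" if "z \<notin> mu N" for j z
  proof -
    have "set xs \<subseteq> A \<Longrightarrow> prod_list xs \<in> mu N" for xs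
      by (induction xs) (use AG mu_mult in auto)
    thus ?thesis using that by (auto simp: tuples_def)
  qed
  have "finite A" "0 \<notin> A" using AG finite_mu[OF N] mu_nonzero[OF N] by (auto intro: finite_subset)
  hence "int (card (tuples A (Suc k) w)) =
      gconv (mu N) (indicator A) (\<lambda>z. int (card (tuples A k z))) w" for w
  proof (cases "w \<in> mu N")
    case True
    thus ?thesis using \<open>finite A\<close> \<open>0 \<notin> A\<close> by (simp add: gconv_indicator[OF N AG] card_tuples_Suc)
  next
    case False
    thus ?thesis by (simp add: gconv_indicator[OF N AG] z)
  qed
  thus ?case using class_function_gconv[OF N P A Suc] by (simp only:)
qed

text \<open>Rotation keeps the product because multiplication is commutative, and q rotations
  restore a list of length q. A list fixed by one rotation is constant, hence given by a single a
  with a^q = z.\<close>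

lemma card_tuples_prime:
  assumes A: "finite A" and q: "prime q"
  shows "[card (tuples A q z) = card {a \<in> A. a ^ q = z}] (mod q)"
proof -
  have "[card (tuples A q z) = card {xs \<in> tuples A q z. rotate1 xs = xs}] (mod q)"
  proof (rule card_cong_card_fixed_points[OF finite_tuples[OF A] q])
    have "prod_list (rotate1 xs) = prod_list xs" for xs :: "complex list"
      by (cases xs) (auto simp: mult.commute)
    thus "rotate1 ` tuples A q z \<subseteq> tuples A q z" by (auto simp: tuples_def)
    fix xs assume "xs \<in> tuples A q z"
    thus "(rotate1 ^^ q) xs = xs" by (simp add: tuples_def flip: rotate_def)
  qed
  also have "{xs \<in> tuples A q z. rotate1 xs = xs} = replicate q ` {a \<in> A. a ^ q = z}"
  proof (intro equalityI subsetI)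
    fix xs assume "xs \<in> {xs \<in> tuples A q z. rotate1 xs = xs}"
    hence xs: "length xs = q" "set xs \<subseteq> A" "prod_list xs = z" "rotate1 xs = xs"
      by (auto simp: tuples_def)
    have step: "xs ! Suc i = xs ! i" if "Suc i < q" for i
      using nth_rotate1[of i xs] xs that by simp
    have "xs ! i = xs ! 0" if "i < q" for i
      using that by (induction i) (auto simp: step)
    then obtain a where a: "a = xs ! 0" "\<And>i. i < q \<Longrightarrow> xs ! i = a" by blast
    hence "xs = replicate q a" using xs by (intro nth_equalityI) auto
    moreover have "a \<in> A" using a xs prime_gt_0_nat[OF q] nth_mem[of 0 xs] by auto
    moreover have "a ^ q = z" using xs(3) calculation by simp
    ultimately show "xs \<in> replicate q ` {a \<in> A. a ^ q = z}" by auto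
  next
    fix xs assume "xs \<in> replicate q ` {a \<in> A. a ^ q = z}"
    then obtain a where a: "a \<in> A" "a ^ q = z" "xs = replicate q a" by auto
    moreover have "rotate1 xs = xs"
      using a by (cases q) (auto simp: replicate_append_same)
    ultimately show "xs \<in> {xs \<in> tuples A q z. rotate1 xs = xs}"
      by (auto simp: tuples_def)
  qed
  also have "card \<dots> = card {a \<in> A. a ^ q = z}"
    using prime_gt_0_nat[OF q] by (intro card_image inj_onI) (auto simp: replicate_eq_replicate)
  finally show ?thesis .
qed

section \<open>Multipliers\<close>

text \<open>Unlike membership in P, this property can be transported through one prime exponent at a
  time, since a power map is at that stage not known to send members to members.\<close>

definition union_of_members :: "complex set set \<Rightarrow> complex set \<Rightarrow> bool" where
  "union_of_members P S \<longleftrightarrow> S \<subseteq> \<Union>P \<and> (\<forall>D\<in>P. D \<inter> S \<noteq> {} \<longrightarrow> D \<subseteq> S)"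

lemma union_of_members_member:
  assumes "set_partition_of G P" "A \<in> P"
  shows "union_of_members P A"
  using assms unfolding set_partition_of_def union_of_members_def by blast

lemma union_of_membersD:
  "union_of_members P S \<Longrightarrow> D \<in> P \<Longrightarrow> s \<in> D \<Longrightarrow> s \<in> S \<Longrightarrow> D \<subseteq> S"
  unfolding union_of_members_def by blast

lemma union_of_membersE:
  assumes "union_of_members P S" "s \<in> S"
  obtains D where "D \<in> P" "s \<in> D" "D \<subseteq> S"
proof -
  have "s \<in> \<Union>P" using assms by (auto simp: union_of_members_def)
  then obtain D where "D \<in> P" "s \<in> D" by auto
  thus thesis using union_of_membersD[OF assms(1) _ _ assms(2)] that by auto
qed

lemma mu_power_cong:
  assumes "a \<in> mu N" "[i = j] (mod N)"
  shows "a ^ i = a ^ j"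
proof -
  have "a ^ i = a ^ (i mod N)" for i
  proof -
    have "a ^ i = a ^ (N * (i div N) + i mod N)" by simp
    also have "\<dots> = a ^ (i mod N)"
      unfolding power_add power_mult using assms by (simp add: mu_def)
    finally show ?thesis .
  qed
  thus ?thesis using assms by (metis cong_def)
qed

lemma mu_power_inverse:
  assumes "coprime m N"
  obtains e :: nat where "\<And>a. a \<in> mu N \<Longrightarrow> (a ^ m) ^ e = a" "e > 0" "coprime e N"
proof -
  obtain e where e: "[m * e = 1] (mod N)" using assms cong_solve_coprime_nat by auto
  \<comment> \<open>The shift by N keeps the residue and makes the exponent positive; e itself may
    be 0 when N = 1.\<close>
  have "[m * (e + N) = m * e] (mod N)" by (simp add: cong_def algebra_simps)
  hence e': "[m * (e + N) = 1] (mod N)" using e cong_trans by blast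
  show thesis
  proof (cases "e + N = 0")
    case False
    show thesis
    proof
      show "(a ^ m) ^ (e + N) = a" if "a \<in> mu N" for a
        using mu_power_cong[OF that e'] by (simp add: power_mult)
      show "coprime (e + N) N" 
        using cong_imp_coprime[OF cong_sym[OF e']] by (simp del: add_mult_distrib2)
    qed (use False in auto)
  next
    case True
    thus thesis using e by simp
  qed
qed

lemma mu_power_inj:
  assumes "coprime m N"
  shows "inj_on (\<lambda>z. z ^ m) (mu N)"
proof -
  obtain e where "\<And>a. a \<in> mu N \<Longrightarrow> (a ^ m) ^ e = a" "e > 0" "coprime e N"
    using mu_power_inverse[OF assms] by blast
  thus ?thesis by (intro inj_on_inverseI[where g = "\<lambda>y. y ^ e"]) simp
qed

text \<open>As q is prime to N, the only q-th root of \<open>s ^ q\<close> in A is s, so the tuple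
  count is 1 modulo q on the whole member D through \<open>s ^ q\<close>. Thus every w in D has a
  number of q-th roots in A that is nonzero modulo q, and in particular has one.\<close>

lemma union_of_members_power_prime:
  assumes N: "N > 0" and P: "unital_partition (mu N) P"
    and S: "union_of_members P S" and q: "prime q" "coprime q N"
  shows "union_of_members P ((\<lambda>z. z ^ q) ` S)"
proof -
  have part: "set_partition_of (mu N) P" and U: "\<Union>P = mu N"
    using P by (auto simp: unital_partition_def set_partition_of_def)
  show ?thesis unfolding union_of_members_def
  proof (intro conjI ballI impI)
    show "(\<lambda>z. z ^ q) ` S \<subseteq> \<Union>P"
      using S unfolding U union_of_members_def by (auto intro: mu_power)
    fix D assume D: "D \<in> P" "D \<inter> (\<lambda>z. z ^ q) ` S \<noteq> {}"
    then obtain s where s: "s \<in> S" "s ^ q \<in> D" by auto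
    then obtain A where A: "A \<in> P" "s \<in> A" "A \<subseteq> S"
      using union_of_membersE[OF S] by metis
    have AG: "A \<subseteq> mu N" using A U by auto
    hence finA: "finite A" using finite_mu[OF N] finite_subset by auto
    show "D \<subseteq> (\<lambda>z. z ^ q) ` S"
    proof
      fix w assume w: "w \<in> D"
      have "int (card (tuples A q w)) = int (card (tuples A q (s ^ q)))"
        using class_function_tuples[OF N P A(1)] D(1) w s(2)
        unfolding class_function_def by blast
      hence "card (tuples A q w) = card (tuples A q (s ^ q))" by simp
      hence "[card {a \<in> A. a ^ q = w} = card {a \<in> A. a ^ q = s ^ q}] (mod q)"
        using card_tuples_prime[OF finA q(1), of w] card_tuples_prime[OF finA q(1), of "s ^ q"]
        by (simp add: cong_def)
      moreover have "{a \<in> A. a ^ q = s ^ q} = {s}"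
        using A AG inj_on_eq_iff[OF mu_power_inj[OF q(2)]] by blast
      ultimately have "[card {a \<in> A. a ^ q = w} = 1] (mod q)" by simp
      hence "card {a \<in> A. a ^ q = w} \<noteq> 0"
        using prime_gt_1_nat[OF q(1)] by (intro notI) (simp add: cong_def)
      hence "{a \<in> A. a ^ q = w} \<noteq> {}" by (metis card.empty)
      thus "w \<in> (\<lambda>z. z ^ q) ` S" using A by blast
    qed
  qed
qed

lemma union_of_members_power:
  assumes N: "N > 0" and P: "unital_partition (mu N) P"
  shows "m > 0 \<Longrightarrow> coprime m N \<Longrightarrow> union_of_members P S \<Longrightarrow> union_of_members P ((\<lambda>z. z ^ m) ` S)"
proof (induction m arbitrary: S rule: less_induct)
  case (less m)
  show ?case
  proof (cases "m = 1")
    case True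
    thus ?thesis using less by simp
  next
    case False
    then obtain q k where q: "prime q" "m = q * k" using prime_factor_nat by (metis dvdE)
    hence k: "0 < k" "k < m" "coprime k N" "coprime q N"
      using less prime_gt_1_nat[OF q(1)] by auto
    have "union_of_members P ((\<lambda>z. z ^ k) ` (\<lambda>z. z ^ q) ` S)"
      by (intro less.IH k union_of_members_power_prime[OF N P _ q(1)] less.prems)
    thus ?thesis unfolding q(2) power_mult image_image .
  qed
qed

text \<open>The image of A is a union of members. If D is one of them, the inverse exponent e sends
  D to a union of members that meets A and so covers A; applying m again shows that D is the whole
  image.\<close>

theorem schur_multiplier:
  assumes N: "N > 0" and P: "unital_partition (mu N) P"
    and A: "A \<in> P" and m: "m > 0" "coprime m N"
  shows "(\<lambda>z. z ^ m) ` A \<in> P"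
proof -
  have part: "set_partition_of (mu N) P" and U: "\<Union>P = mu N"
    and ne: "\<And>D. D \<in> P \<Longrightarrow> D \<noteq> {} \<and> D \<subseteq> mu N"
    using P by (auto simp: unital_partition_def set_partition_of_def)
  obtain e where e: "\<And>a. a \<in> mu N \<Longrightarrow> (a ^ m) ^ e = a" "e > 0" "coprime e N"
    using mu_power_inverse[OF m(2)] by blast
  let ?B = "(\<lambda>z. z ^ m) ` A"
  have B: "union_of_members P ?B"
    by (intro union_of_members_power[OF N P] m union_of_members_member[OF part A])
  obtain a where a: "a \<in> A" using ne[OF A] by auto
  have "a ^ m \<in> \<Union>P" using B a by (auto simp: union_of_members_def)
  then obtain D where D: "D \<in> P" "a ^ m \<in> D" by auto
  have DB: "D \<subseteq> ?B" using union_of_membersD[OF B D] a by simp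
  have "union_of_members P ((\<lambda>z. z ^ e) ` D)"
    by (intro union_of_members_power[OF N P] e union_of_members_member[OF part D(1)])
  moreover have "a \<in> (\<lambda>z. z ^ e) ` D"
    using e(1)[of a] D a ne[OF A] by (auto simp: image_iff intro!: bexI[of _ "a ^ m"])
  ultimately have sub: "A \<subseteq> (\<lambda>z. z ^ e) ` D" using union_of_membersD A a by blast
  have "?B \<subseteq> D"
  proof
    fix w assume "w \<in> ?B"
    then obtain c where c: "c \<in> A" "w = c ^ m" by auto
    then obtain d where d: "d \<in> D" "c = d ^ e" using sub by auto
    then obtain c' where c': "c' \<in> A" "d = c' ^ m" using DB by auto
    hence "c = c'" using d e(1)[of c'] ne[OF A] by auto
    thus "w \<in> D" using c c' d by simp
  qed
  thus ?thesis using DB D by (metis subset_antisym)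
qed

section \<open>Cosets in a cyclic group of prime power order\<close>

text \<open>The powers of \<alpha> reach every totative, so the order of \<alpha> is at least
  \<open>totient M\<close>; it also divides \<open>totient M\<close>, hence equals it.\<close>

lemma unit_generator_power_cong_iff:
  assumes \<alpha>: "unit_generator M \<alpha>" and M: "M > 1"
  shows "[\<alpha> ^ i = \<alpha> ^ j] (mod int M) \<longleftrightarrow> [i = j] (mod totient M)"
proof -
  define a where "a = nat (\<alpha> mod int M)"
  have a: "[int a = \<alpha>] (mod int M)" using M by (simp add: a_def cong_def)
  have cop: "coprime M a"
    using \<alpha> cong_imp_coprime[OF cong_sym[OF a]] by (simp add: unit_generator_def coprime_commute)
  have "totatives M \<subseteq> (\<lambda>k. a ^ k mod M) ` {..<ord M a}"
  proof
    fix y assume y: "y \<in> totatives M"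
    hence "coprime (int y) (int M)" by (simp add: totatives_def)
    then obtain j where "[\<alpha> ^ j = int y] (mod int M)" using \<alpha> unfolding unit_generator_def by blast
    hence "[int (a ^ j) = int y] (mod int M)"
      using cong_pow[OF a, of j] cong_trans by (simp only: of_nat_power) blast
    hence "[a ^ j = y] (mod M)" by (simp only: cong_int_iff)
    moreover have "[a ^ (j mod ord M a) = a ^ j] (mod M)"
      by (subst order_divides_expdiff[OF cop]) (simp add: cong_def)
    ultimately have "a ^ (j mod ord M a) mod M = y"
      using totatives_less[OF y M] by (simp add: cong_def)
    moreover have "j mod ord M a < ord M a" using cop by simp
    ultimately show "y \<in> (\<lambda>k. a ^ k mod M) ` {..<ord M a}" by (auto simp: image_iff)
  qed
  hence "totient M \<le> card ((\<lambda>k. a ^ k mod M) ` {..<ord M a})"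
    unfolding totient_def by (intro card_mono) auto
  also have "\<dots> \<le> ord M a" using card_image_le[of "{..<ord M a}"] by simp
  finally have "ord M a = totient M"
    using order_divides_totient[OF cop] M by (simp add: dvd_imp_le dual_order.antisym)
  hence "[a ^ i = a ^ j] (mod M) \<longleftrightarrow> [i = j] (mod totient M)"
    using order_divides_expdiff[OF cop] by simp
  moreover have "[\<alpha> ^ i = \<alpha> ^ j] (mod int M) \<longleftrightarrow> [int (a ^ i) = int (a ^ j)] (mod int M)"
    using cong_pow[OF a] by (simp add: cong_def)
  ultimately show ?thesis by (simp only: cong_int_iff)
qed

section \<open>Symmetry of the structure constants\<close>

lemma gconv_commute: "gconv G f g z = gconv G g f z"
  unfolding gconv_def
  by (rule sum.reindex_bij_witness[where i = prod.swap and j = prod.swap])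
     (auto simp: mult.commute)

lemma sum_indicator_card:
  assumes "finite C"
  shows "(\<Sum>z\<in>C. indicator B (g z)) = int (card {z \<in> C. g z \<in> B})"
  using sum.inter_filter[OF assms, of "\<lambda>_. 1::int" "\<lambda>z. g z \<in> B"]
  by (simp add: indicator_def of_bool_def)

text \<open>Both sides count the solutions of \<open>a * b = z\<close> with \<open>a \<in> A\<close>, \<open>b \<in> B\<close>, \<open>z \<in> C\<close>,
  the right one in the form \<open>a * inverse z = inverse b\<close>.\<close>

lemma structure_constants_symmetric:
  assumes N: "N > 0" and P: "set_partition_of (mu N) P" and inv: "\<forall>A\<in>P. inverse ` A \<in> P"
    and A: "A \<in> P" and B: "B \<in> P" and C: "C \<in> P"
    and c: "struct_coeffs (mu N) P A B c" and e: "struct_coeffs (mu N) P A (inverse ` C) e"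
  shows "c C * int (card C) = e (inverse ` B) * int (card (inverse ` B))"
proof -
  note fin = finite_mu[OF N]
  have sub: "D \<subseteq> mu N" if "D \<in> P" for D using P that by (simp add: set_partition_of_def)
  have total: "d C * int (card C) = (\<Sum>a\<in>A. int (card {z \<in> C. z / a \<in> B}))"
    if B: "B \<in> P" and C: "C \<in> P" and d: "struct_coeffs (mu N) P A B d" for B C d
  proof -
    have "d C * int (card C) = (\<Sum>z\<in>C. gconv (mu N) (indicator A) (indicator B) z)"
      using d partition_sum_indicator(1)[OF P fin C] by (simp add: struct_coeffs_def)
    also have "\<dots> = (\<Sum>z\<in>C. \<Sum>a\<in>A. indicator B (z / a))"
      using sub[OF C] by (intro sum.cong refl) (auto simp: gconv_indicator[OF N sub[OF A]])
    also have "\<dots> = (\<Sum>a\<in>A. \<Sum>z\<in>C. indicator B (z / a))" by (rule sum.swap)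
    also have "\<dots> = (\<Sum>a\<in>A. int (card {z \<in> C. z / a \<in> B}))"
      using partition_finite[OF P fin] C by (simp add: sum_indicator_card)
    finally show ?thesis .
  qed
  have "card {z \<in> C. z / a \<in> B} = card {w \<in> inverse ` B. w / a \<in> inverse ` C}" if "a \<in> A" for a
  proof (rule bij_betw_same_card)
    have a: "a \<noteq> 0" using that sub[OF A] mu_nonzero[OF N] by auto
    show "bij_betw (\<lambda>z. a / z) {z \<in> C. z / a \<in> B} {w \<in> inverse ` B. w / a \<in> inverse ` C}"
    proof (rule bij_betw_byWitness[where f' = "\<lambda>w. a / w"])
      have inv_mem: "z \<in> inverse ` D \<longleftrightarrow> inverse z \<in> D" for z :: complex and D
        by (metis image_iff inverse_inverse_eq)
      show "(\<lambda>z. a / z) ` {z \<in> C. z / a \<in> B} \<subseteq> {w \<in> inverse ` B. w / a \<in> inverse ` C}"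
        using a unfolding inv_mem by (auto simp: field_simps)
      show "(\<lambda>w. a / w) ` {w \<in> inverse ` B. w / a \<in> inverse ` C} \<subseteq> {z \<in> C. z / a \<in> B}"
        using a unfolding inv_mem by (auto simp: field_simps)
    qed (use a in auto)
  qed
  thus ?thesis using total[OF B C c] total[OF _ _ e] inv B C by simp
qed

section \<open>Exponents, levels and cosets\<close>

locale cyclic_p_group =
  fixes p n :: nat and x :: complex
  assumes prime_p: "prime p" and n_pos: "1 \<le> n"
    and generator: "is_generator (p ^ n) x"
begin

lemma p_gt_1: "1 < p"
  using prime_p by (rule prime_gt_1_nat)

lemma prime_int_p: "prime (int p)"
  using prime_p by simp

lemma order_pos: "0 < p ^ n"
  using p_gt_1 by simp

lemma order_gt_1: "1 < p ^ n"
  using one_less_power[OF p_gt_1] n_pos by simp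

lemma x_in_mu: "x \<in> mu (p ^ n)"
  using generator by (simp add: is_generator_def)

lemma x_nonzero [simp]: "x \<noteq> 0"
  using mu_nonzero[OF order_pos x_in_mu] .

lemma powi_nat_mod: "x powi j = x ^ nat (j mod int (p ^ n))"
proof -
  let ?N = "int (p ^ n)"
  have "x powi ?N = 1" unfolding power_int_of_nat using x_in_mu by (simp add: mu_def)
  hence "x powi (?N * (j div ?N)) = 1" by (simp only: power_int_mult power_int_1_left)
  moreover have "x powi j = x powi (?N * (j div ?N)) * x powi (j mod ?N)"
    by (subst power_int_add[symmetric]) simp_all
  ultimately have "x powi j = x powi (j mod ?N)" by simp
  also have "\<dots> = x ^ nat (j mod ?N)"
    using order_pos by (intro power_int_nonneg_exp pos_mod_sign) linarith
  finally show ?thesis by simp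
qed

lemma powi_in_mu: "x powi j \<in> mu (p ^ n)"
  unfolding powi_nat_mod by (rule mu_power[OF x_in_mu])

lemma mu_powiE:
  assumes "z \<in> mu (p ^ n)"
  obtains j where "z = x powi j"
  using assms generator unfolding is_generator_def by (metis power_int_of_nat)

text \<open>The powers of x with exponents below p^n exhaust a group of p^n elements, so they are
  distinct. This is how the order of x is extracted from its being a generator.\<close>

lemma powi_eq_iff: "x powi i = x powi j \<longleftrightarrow> [i = j] (mod int (p ^ n))"
proof
  assume "[i = j] (mod int (p ^ n))"
  thus "x powi i = x powi j" unfolding powi_nat_mod cong_def by simp
next
  have "mu (p ^ n) = (\<lambda>j. x ^ j) ` {..<p ^ n}"
  proof
    show "mu (p ^ n) \<subseteq> (\<lambda>j. x ^ j) ` {..<p ^ n}"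
    proof
      fix z assume "z \<in> mu (p ^ n)"
      then obtain j where "z = x ^ j" using generator by (auto simp: is_generator_def)
      hence "z = x ^ (j mod p ^ n)"
        using mu_power_cong[OF x_in_mu, of j "j mod p ^ n"] by (simp add: cong_def)
      thus "z \<in> (\<lambda>j. x ^ j) ` {..<p ^ n}" using order_pos by auto
    qed
  qed (auto intro: mu_power[OF x_in_mu])
  hence inj: "inj_on (\<lambda>j. x ^ j) {..<p ^ n}"
    using card_mu[OF order_pos] by (intro eq_card_imp_inj_on) auto
  assume "x powi i = x powi j"
  hence "x ^ nat (i mod int (p ^ n)) = x ^ nat (j mod int (p ^ n))"
    by (simp only: powi_nat_mod)
  moreover have less: "nat (m mod int (p ^ n)) < p ^ n" for m
    using order_pos by (subst nat_less_iff) (simp_all del: of_nat_power)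
  ultimately have "nat (i mod int (p ^ n)) = nat (j mod int (p ^ n))"
    using inj_onD[OF inj] by simp
  thus "[i = j] (mod int (p ^ n))"
    using order_pos by (simp add: cong_def eq_nat_nat_iff del: of_nat_power)
qed

text \<open>For c \<le> n this is the coset through \<open>x powi j\<close> of the subgroup of order
  p^(n-c). Exponents matter only modulo p^n, so membership is a congruence modulo p^c on any
  exponent of the element.\<close>

definition coset :: "int \<Rightarrow> nat \<Rightarrow> complex set" where
  "coset j c = {x powi m | m. [m = j] (mod int p ^ c)}"

lemma powi_in_coset_iff:
  assumes "c \<le> n"
  shows "x powi m \<in> coset j c \<longleftrightarrow> [m = j] (mod int p ^ c)"
proof
  assume "x powi m \<in> coset j c"
  then obtain m' where m': "x powi m = x powi m'" "[m' = j] (mod int p ^ c)"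
    by (auto simp: coset_def)
  hence "[m = m'] (mod int p ^ c)"
    using cong_dvd_modulus[of m m' "int (p ^ n)" "int p ^ c"] assms
    by (simp add: powi_eq_iff le_imp_power_dvd)
  thus "[m = j] (mod int p ^ c)" using m' cong_trans by blast
qed (auto simp: coset_def)

lemma cosetE:
  assumes "z \<in> coset j c"
  obtains m where "z = x powi m" "[m = j] (mod int p ^ c)"
  using assms by (auto simp: coset_def)

lemma coset_cong: "[i = j] (mod int p ^ c) \<Longrightarrow> coset i c = coset j c"
  unfolding coset_def using cong_trans cong_sym by blast

lemma coset_subset: "coset j c \<subseteq> mu (p ^ n)"
  by (auto simp: coset_def powi_in_mu)

lemma coset_order: "coset j n = {x powi j}"
  by (auto simp: coset_def powi_eq_iff intro: exI[of _ j])

lemma card_coset: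
  assumes c: "c \<le> n"
  shows "card (coset j c) = p ^ (n - c)"
proof -
  have pn: "int p ^ n = int p ^ c * int p ^ (n - c)" using c by (simp flip: power_add)
  have pos: "int p ^ k > 0" for k using p_gt_1 by simp
  have "coset j c = (\<lambda>s. x powi (j + int p ^ c * int s)) ` {..<p ^ (n - c)}"
  proof (intro equalityI subsetI)
    fix z assume "z \<in> coset j c"
    then obtain m where m: "z = x powi m" "[m = j] (mod int p ^ c)" by (rule cosetE)
    then obtain s where s: "m - j = int p ^ c * s" by (auto simp: cong_iff_dvd_diff)
    define t where "t = nat (s mod int p ^ (n - c))"
    have t: "int t = s mod int p ^ (n - c)" unfolding t_def using pos_mod_sign[OF pos[of "n - c"]] by simp
    have "int p ^ n dvd int p ^ c * (s - int t)"
      unfolding pn t by (intro mult_dvd_mono) (auto simp: mod_eq_dvd_iff[symmetric])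
    moreover have "m - (j + int p ^ c * int t) = int p ^ c * (s - int t)"
      using s by (simp add: algebra_simps)
    ultimately have "z = x powi (j + int p ^ c * int t)"
      unfolding m powi_eq_iff cong_iff_dvd_diff by simp
    moreover have "int t < int (p ^ (n - c))" unfolding t using pos_mod_bound[OF pos[of "n - c"]] by simp
    ultimately show "z \<in> (\<lambda>s. x powi (j + int p ^ c * int s)) ` {..<p ^ (n - c)}" by auto
  next
    fix z assume "z \<in> (\<lambda>s. x powi (j + int p ^ c * int s)) ` {..<p ^ (n - c)}"
    thus "z \<in> coset j c" by (auto simp: powi_in_coset_iff[OF c] cong_iff_dvd_diff)
  qed
  moreover have "inj_on (\<lambda>s. x powi (j + int p ^ c * int s)) {..<p ^ (n - c)}"
  proof (rule inj_onI)
    fix s t assume st: "s \<in> {..<p ^ (n - c)}" "t \<in> {..<p ^ (n - c)}"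
      and "x powi (j + int p ^ c * int s) = x powi (j + int p ^ c * int t)"
    hence "int p ^ c * int p ^ (n - c) dvd int p ^ c * (int s - int t)"
      unfolding powi_eq_iff cong_iff_dvd_diff of_nat_power pn by (simp add: algebra_simps)
    hence "[int s = int t] (mod int (p ^ (n - c)))"
      using p_gt_1 by (simp add: cong_iff_dvd_diff)
    hence "[s = t] (mod p ^ (n - c))" by (simp only: cong_int_iff)
    thus "s = t" using st by (auto simp: cong_def)
  qed
  ultimately show ?thesis by (simp add: card_image)
qed

lemma level_decomposition:
  obtains k u where "k \<le> n" "coprime u (int p)" "[m = int p ^ k * u] (mod int p ^ n)"
proof (cases "int p ^ n dvd m")
  case True
  \<comment> \<open>Multiples of p^n, the exponents of the identity, receive level n, with 1 as an
    arbitrary unit part.\<close>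
  thus thesis using that[of n 1] by (simp add: cong_iff_dvd_diff)
next
  case False
  hence "m \<noteq> 0" by auto
  then obtain u where u: "m = int p ^ multiplicity (int p) m * u" "\<not> int p dvd u"
    using multiplicity_decompose'[of m "int p"] prime_int_p by (metis not_prime_unit)
  have "multiplicity (int p) m < n"
    using False multiplicity_dvd'[of n "int p" m] by (meson not_le)
  moreover have "coprime u (int p)"
    using u prime_int_p prime_imp_coprime[of "int p" u] by (simp add: coprime_commute)
  ultimately show thesis using that[of "multiplicity (int p) m" u] u by simp
qed

text \<open>A modulus p^c with c > k still sees the exact power of p dividing m. This is what b_k
  \<ge> 1 provides for a member of level k < n: all its elements have level exactly k.\<close>

lemma level_not_dvd:
  assumes "[m = int p ^ k * u] (mod int p ^ c)" "k < c" "coprime u (int p)" "k < l"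
  shows "\<not> int p ^ l dvd m"
proof
  assume "int p ^ l dvd m"
  moreover have "int p ^ Suc k dvd int p ^ l" using assms by (intro le_imp_power_dvd) simp
  ultimately have 1: "int p ^ Suc k dvd m" using dvd_trans by blast
  have "int p ^ Suc k dvd int p ^ c" using assms by (intro le_imp_power_dvd) simp
  hence "int p ^ Suc k dvd m - int p ^ k * u"
    using assms(1) dvd_trans by (auto simp: cong_iff_dvd_diff)
  hence "int p ^ Suc k dvd int p ^ k * u" using 1 dvd_diff[OF 1] by fastforce
  hence "int p dvd u" using p_gt_1 by (simp add: mult.commute)
  thus False using assms(3) prime_int_p by (metis coprime_common_divisor dvd_refl not_prime_unit)
qed

lemma cong_power_mult:
  "[u = v] (mod int p ^ c) \<Longrightarrow> [int p ^ k * u = int p ^ k * v] (mod int p ^ (k + c))"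
  by (auto simp: cong_iff_dvd_diff power_add simp flip: right_diff_distrib)

lemma unit_generator_power:
  assumes \<alpha>: "unit_generator (p ^ n) \<alpha>" and c: "1 \<le> c" "c \<le> n"
  shows "unit_generator (p ^ c) \<alpha>"
  unfolding unit_generator_def
proof (intro conjI allI impI)
  have "coprime \<alpha> (int p)" using \<alpha> n_pos by (simp add: unit_generator_def)
  thus "coprime \<alpha> (int (p ^ c))" by simp
  fix y :: int assume "coprime y (int (p ^ c))"
  hence "coprime y (int (p ^ n))" using c by simp
  then obtain j where "[\<alpha> ^ j = y] (mod int (p ^ n))" using \<alpha> unfolding unit_generator_def by blast
  hence "[\<alpha> ^ j = y] (mod int (p ^ c))"
    using c by (elim cong_dvd_modulus) (simp add: le_imp_power_dvd)
  thus "\<exists>j. [\<alpha> ^ j = y] (mod int (p ^ c))" by blast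
qed

lemma totient_power_mult:
  assumes "1 \<le> b" "b \<le> c"
  shows "totient (p ^ c) = totient (p ^ b) * p ^ (c - b)"
proof -
  have "c - 1 = b - 1 + (c - b)" using assms by simp
  hence "p ^ (c - 1) = p ^ (b - 1) * p ^ (c - b)" by (simp only: power_add)
  moreover have "totient (p ^ i) = p ^ (i - 1) * (p - 1)" if "1 \<le> i" for i
    using that by (simp add: totient_prime_power[OF prime_p])
  ultimately show ?thesis using assms by (simp only: le_trans[OF assms] mult_ac)
qed

text \<open>Below level n the unit part of an exponent matters only modulo p^(n-k). There
  \<alpha>^phi(p^b) generates the group of units congruent to 1 modulo p^b, whose order is
  p^(n-k-b); so the range of t is exactly one turn, and the unit parts fill a residue class modulo
  p^b. At level n both sides are {1}.\<close>

lemma A_set_eq_coset: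
  assumes \<alpha>: "unit_generator (p ^ n) \<alpha>" and k: "k + b k \<le> n" "k < n \<Longrightarrow> 1 \<le> b k"
  shows "A_set p n b x \<alpha> i k = coset (int p ^ k * \<alpha> ^ i) (k + b k)"
proof (cases "k < n")
  case False
  hence "k = n" "b k = 0" using k by auto
  thus ?thesis by (auto simp: A_set_def coset_order)
next
  case True
  let ?b = "b k" let ?r = "n - k - ?b" let ?u = "totient (p ^ ?b)"
  have b: "1 \<le> ?b" "?b \<le> n" "?b \<le> n - k" using True k by auto
  have gen: "[\<alpha> ^ i = \<alpha> ^ j] (mod int p ^ c) \<longleftrightarrow> [i = j] (mod totient (p ^ c))"
    if "1 \<le> c" "c \<le> n" for i j c
    using unit_generator_power_cong_iff[OF unit_generator_power[OF \<alpha> that], of i j]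
      one_less_power[OF p_gt_1, of c] that by simp
  show ?thesis
  proof (intro equalityI subsetI)
    fix z assume "z \<in> A_set p n b x \<alpha> i k"
    then obtain t where t: "z = x powi (int (p ^ k) * \<alpha> ^ i * (\<alpha> ^ ?u) ^ t)"
      by (auto simp: A_set_def)
    have "[\<alpha> ^ (i + ?u * t) = \<alpha> ^ i] (mod int p ^ ?b)"
      using gen[OF b(1,2)] by (simp add: cong_def)
    hence "[int p ^ k * \<alpha> ^ (i + ?u * t) = int p ^ k * \<alpha> ^ i] (mod int p ^ (k + ?b))"
      by (rule cong_power_mult)
    thus "z \<in> coset (int p ^ k * \<alpha> ^ i) (k + ?b)"
      unfolding t powi_in_coset_iff[OF k(1)] by (simp add: power_add power_mult mult.assoc)
  next
    fix z assume "z \<in> coset (int p ^ k * \<alpha> ^ i) (k + ?b)"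
    then obtain m where m: "z = x powi m" "[m = int p ^ k * \<alpha> ^ i] (mod int p ^ (k + ?b))"
      by (rule cosetE)
    have "int p ^ k dvd m - int p ^ k * \<alpha> ^ i"
      using m(2) by (meson cong_iff_dvd_diff dvd_trans le_add1 le_imp_power_dvd)
    hence "int p ^ k dvd m" by (metis diff_add_cancel dvd_add dvd_triv_left)
    then obtain w where w: "m = int p ^ k * w" by auto
    have "int p ^ k * int p ^ ?b dvd int p ^ k * (w - \<alpha> ^ i)"
      using m(2) unfolding w cong_iff_dvd_diff power_add by (simp add: right_diff_distrib)
    hence wb: "[w = \<alpha> ^ i] (mod int p ^ ?b)" using p_gt_1 by (simp add: cong_iff_dvd_diff)
    have "coprime (\<alpha> ^ i) (int p ^ ?b)"
      using \<alpha> n_pos by (simp add: unit_generator_def)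
    hence "coprime w (int p ^ ?b)" using wb cong_imp_coprime cong_sym by blast
    hence "coprime w (int (p ^ n))" using b by simp
    then obtain j where j: "[\<alpha> ^ j = w] (mod int (p ^ n))" using \<alpha> unfolding unit_generator_def by blast
    have jc: "[\<alpha> ^ j = w] (mod int p ^ c)" if "c \<le> n" for c
      using j that by (metis cong_dvd_modulus le_imp_power_dvd of_nat_power)
    have "[j = i] (mod ?u)" using cong_trans[OF jc[OF b(2)] wb] gen[OF b(1,2)] by simp
    \<comment> \<open>Adding a multiple of the period of \<alpha> modulo p^(n-k) makes the exponent
      at least i without changing the power, so that the difference from i is a natural multiple of
      \<open>?u\<close>.\<close>
    hence "[j + totient (p ^ (n - k)) * i = i] (mod ?u)"
      unfolding totient_power_mult[OF b(1,3)] by (simp add: cong_def mult.assoc)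
    moreover have le: "i \<le> j + totient (p ^ (n - k)) * i"
    proof -
      have "1 \<le> totient (p ^ (n - k))" using p_gt_1 by (simp add: Suc_le_eq)
      from mult_le_mono1[OF this, of i] show ?thesis by linarith
    qed
    ultimately have "?u dvd j + totient (p ^ (n - k)) * i - i" by (simp add: cong_altdef_nat)
    then obtain s where "j + totient (p ^ (n - k)) * i - i = ?u * s" by (rule dvdE)
    hence s: "j + totient (p ^ (n - k)) * i = i + ?u * s" using le by simp
    \<comment> \<open>Since \<open>?u * p ^ ?r\<close> is the full period
      \<open>totient (p ^ (n - k))\<close>, s may be reduced into the range allowed by
      \<open>A_set\<close>.\<close>
    define t where "t = s mod p ^ ?r"
    have t: "t < p ^ ?r" using p_gt_1 by (simp add: t_def)
    have "[?u * t = ?u * s] (mod ?u * p ^ ?r)"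
      unfolding cong_def t_def by (simp only: mult_mod_right[symmetric] mod_mod_trivial)
    hence "[i + ?u * t = i + ?u * s] (mod ?u * p ^ ?r)" by (rule cong_add[OF cong_refl])
    hence "[i + ?u * t = j + totient (p ^ (n - k)) * i] (mod totient (p ^ (n - k)))"
      unfolding s unfolding totient_power_mult[OF b(1,3)] .
    moreover have "[j + totient (p ^ (n - k)) * i = j] (mod totient (p ^ (n - k)))"
      by (simp add: cong_def)
    ultimately have "[j = i + ?u * t] (mod totient (p ^ (n - k)))"
      using cong_trans cong_sym by blast
    hence "[\<alpha> ^ j = \<alpha> ^ (i + ?u * t)] (mod int p ^ (n - k))"
      using gen[of "n - k"] True by simp
    hence "[w = \<alpha> ^ (i + ?u * t)] (mod int p ^ (n - k))"
      using jc[of "n - k"] cong_trans cong_sym by (metis diff_le_self)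
    hence "[int p ^ k * w = int p ^ k * \<alpha> ^ (i + ?u * t)] (mod int p ^ (k + (n - k)))"
      by (rule cong_power_mult)
    hence "z = x powi (int p ^ k * \<alpha> ^ (i + ?u * t))"
      using True by (simp add: m w powi_eq_iff)
    thus "z \<in> A_set p n b x \<alpha> i k"
      using t by (auto simp: A_set_def power_add power_mult mult.assoc)
  qed
qed

end

section \<open>The coset families are fusion partitions\<close>

lemma admissible_mono:
  assumes b: "admissible_b n b" and "k \<le> l" "l \<le> n"
  shows "k + b k \<le> l + b l"
  using assms(2,3)
proof (induction l rule: dec_induct)
  case (step l)
  have "b l \<le> b (Suc l) + 1" using b step.prems by (auto simp: admissible_b_def)
  thus ?case using step by simp
qed simp

lemma admissible_bounds:
  assumes b: "admissible_b n b"
  shows "k \<le> n \<Longrightarrow> k + b k \<le> n" and "k < n \<Longrightarrow> 1 \<le> b k" and "b n = 0"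
  using b admissible_mono[OF b, of k n] by (auto simp: admissible_b_def)

context cyclic_p_group
begin

text \<open>The unit part runs over all integers prime to p, with repetitions. Neither \<alpha> nor
  a bounded index remains, so independence of the choice of \<alpha> is built in.\<close>

definition coset_family :: "(nat \<Rightarrow> nat) \<Rightarrow> complex set set" where
  "coset_family b = {coset (int p ^ k * u) (k + b k) | k u. k \<le> n \<and> coprime u (int p)}"

lemma coset_familyE:
  assumes "D \<in> coset_family b"
  obtains k u where "D = coset (int p ^ k * u) (k + b k)" "k \<le> n" "coprime u (int p)"
  using assms by (auto simp: coset_family_def)

lemma fusion_family_eq:
  assumes \<alpha>: "unit_generator (p ^ n) \<alpha>"
    and b: "\<And>k. k \<le> n \<Longrightarrow> k + b k \<le> n" "\<And>k. k < n \<Longrightarrow> 1 \<le> b k"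
  shows "fusion_family p n b x \<alpha> = coset_family b"
proof (intro equalityI subsetI)
  have cop: "coprime \<alpha> (int p)" using \<alpha> n_pos by (simp add: unit_generator_def)
  {
    fix D assume "D \<in> fusion_family p n b x \<alpha>"
    then obtain i k where "D = A_set p n b x \<alpha> i k" "k \<le> n" by (auto simp: fusion_family_def)
    moreover from this have "D = coset (int p ^ k * \<alpha> ^ i) (k + b k)"
      using A_set_eq_coset[where b = b, OF \<alpha> b(1) b(2)] by simp
    ultimately show "D \<in> coset_family b" using cop unfolding coset_family_def by fastforce
  next
    fix D assume "D \<in> coset_family b"
    then obtain k u where D: "D = coset (int p ^ k * u) (k + b k)" "k \<le> n" "coprime u (int p)"
      by (rule coset_familyE)
    let ?u = "totient (p ^ b k)"
    have "coprime u (int (p ^ n))" using D by simp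
    then obtain j where j: "[\<alpha> ^ j = u] (mod int (p ^ n))" using \<alpha> unfolding unit_generator_def by blast
    \<comment> \<open>D depends only on u modulo \<open>p ^ b k\<close>. For \<open>b k > 0\<close>
      the order of \<alpha> there is \<open>?u\<close>, so the index can be taken below it; for
      \<open>b k = 0\<close> the modulus is 1.\<close>
    have "[\<alpha> ^ (j mod ?u) = u] (mod int p ^ b k)"
    proof (cases "b k = 0")
      case False
      have bk: "1 \<le> b k" "b k \<le> n" using False b(1)[OF D(2)] by auto
      have "[\<alpha> ^ (j mod ?u) = \<alpha> ^ j] (mod int (p ^ b k))"
        using unit_generator_power_cong_iff[OF unit_generator_power[OF \<alpha> bk]]
          one_less_power[OF p_gt_1, of "b k"] False by (simp add: cong_def)
      moreover have "[\<alpha> ^ j = u] (mod int (p ^ b k))"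
        using cong_dvd_modulus[OF j] bk by (simp add: le_imp_power_dvd)
      ultimately show ?thesis using cong_trans by (simp only: of_nat_power) blast
    qed simp
    hence "[int p ^ k * \<alpha> ^ (j mod ?u) = int p ^ k * u] (mod int p ^ (k + b k))"
      by (rule cong_power_mult)
    hence "D = A_set p n b x \<alpha> (j mod ?u) k"
      using A_set_eq_coset[where b = b, OF \<alpha> b(1)[OF D(2)] b(2)] coset_cong D(1) by simp
    moreover have "j mod ?u < ?u" using p_gt_1 by simp
    ultimately show "D \<in> fusion_family p n b x \<alpha>" using D(2) unfolding fusion_family_def by blast
  }
qed

lemma cond_p_coset_family:
  assumes "\<And>k. k \<le> n \<Longrightarrow> k + b k \<le> n"
  shows "cond_p p (coset_family b)"
  unfolding cond_p_def using assms card_coset by (metis coset_familyE)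

section \<open>The family attached to an admissible function\<close>

context
  fixes b assumes b: "admissible_b n b"
begin

lemma level_less:
  assumes "k \<le> n" "k < l" "l \<le> n"
  shows "k < k + b k"
  using admissible_bounds(2)[OF b, of k] assms by simp

lemma set_partition_coset_family: "set_partition_of (mu (p ^ n)) (coset_family b)"
  unfolding set_partition_of_def
proof (intro conjI ballI impI)
  fix D assume D: "D \<in> coset_family b"
  then obtain k u where "D = coset (int p ^ k * u) (k + b k)" by (rule coset_familyE)
  thus "D \<noteq> {}" "D \<subseteq> mu (p ^ n)"
    using coset_subset by (auto simp: coset_def intro!: exI[of _ "int p ^ k * u"])
next
  fix D E assume D: "D \<in> coset_family b" and E: "E \<in> coset_family b" and neq: "D \<noteq> E"
  obtain k u where k: "D = coset (int p ^ k * u) (k + b k)" "k \<le> n" "coprime u (int p)"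
    using D by (rule coset_familyE)
  obtain l v where l: "E = coset (int p ^ l * v) (l + b l)" "l \<le> n" "coprime v (int p)"
    using E by (rule coset_familyE)
  show "D \<inter> E = {}"
  proof (rule ccontr)
    assume "D \<inter> E \<noteq> {}"
    then obtain z where z: "z \<in> D" "z \<in> E" by auto
    obtain m where m: "z = x powi m" "[m = int p ^ k * u] (mod int p ^ (k + b k))"
      using z k by (auto elim: cosetE)
    have m': "[m = int p ^ l * v] (mod int p ^ (l + b l))"
      using z l powi_in_coset_iff[OF admissible_bounds(1)[OF b]] m(1) by simp
    have dvd: "int p ^ i dvd m" if "[m = int p ^ i * w] (mod int p ^ (i + c))" for i c w
      using that cong_dvd_iff cong_dvd_modulus by (metis dvd_triv_left le_add1 le_imp_power_dvd)
    \<comment> \<open>Each congruence fixes the exact valuation of m, so overlapping members have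
      one level, hence one modulus.\<close>
    have "k = l"
    proof (cases k l rule: linorder_cases)
      case less
      thus ?thesis using level_not_dvd[OF m(2) level_less k(3) less] k l dvd[OF m'] by blast
    next
      case greater
      thus ?thesis using level_not_dvd[OF m' level_less l(3) greater] k l dvd[OF m(2)] by blast
    qed
    hence "D = E" using k l m m' coset_cong cong_trans cong_sym by metis
    thus False using neq by simp
  qed
next
  show "\<Union> (coset_family b) = mu (p ^ n)"
  proof (intro equalityI subsetI)
    fix z assume "z \<in> mu (p ^ n)"
    then obtain m where m: "z = x powi m" by (rule mu_powiE)
    obtain k u where k: "k \<le> n" "coprime u (int p)" "[m = int p ^ k * u] (mod int p ^ n)"
      by (rule level_decomposition)
    have kb: "k + b k \<le> n" using admissible_bounds(1)[OF b k(1)] .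
    have "[m = int p ^ k * u] (mod int p ^ (k + b k))"
      using cong_dvd_modulus[OF k(3)] kb by (simp add: le_imp_power_dvd)
    hence "z \<in> coset (int p ^ k * u) (k + b k)" using m powi_in_coset_iff[OF kb] by simp
    thus "z \<in> \<Union> (coset_family b)" using k unfolding coset_family_def by blast
  qed (auto simp: coset_family_def dest: subsetD[OF coset_subset])
qed

text \<open>Let \<open>A\<close> be the member of smaller level \<open>k\<close>. A member of level at least \<open>k\<close> lies in one coset
  of the stabiliser of \<open>A\<close>, and translation matches the two sums; a member of smaller level does
  not meet the subgroup generated by \<open>A\<close> and \<open>B\<close>, so that both sums vanish.\<close>

lemma product_constant_on_members:
  assumes A: "A = coset (int p ^ k * u) (k + b k)" and B: "B = coset (int p ^ l * v) (l + b l)"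
    and kl: "k \<le> l" "l \<le> n" and D: "D \<in> coset_family b" and z: "z \<in> D" and w: "w \<in> D"
  shows "(\<Sum>a\<in>A. indicator B (z / a) :: int) = (\<Sum>a\<in>A. indicator B (w / a))"
proof -
  obtain f t where f: "D = coset (int p ^ f * t) (f + b f)" "f \<le> n" "coprime t (int p)"
    using D by (rule coset_familyE)
  obtain i where i: "z = x powi i" "[i = int p ^ f * t] (mod int p ^ (f + b f))"
    using z unfolding f by (rule cosetE)
  obtain j where j: "w = x powi j" "[j = int p ^ f * t] (mod int p ^ (f + b f))"
    using w unfolding f by (rule cosetE)
  have kb: "k + b k \<le> n" using admissible_bounds(1)[OF b, of k] kl by simp
  show ?thesis
  proof (cases "k \<le> f")
    case True
    have "[i = j] (mod int p ^ (f + b f))" using i j cong_trans cong_sym by blast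
    \<comment> \<open>Admissibility acts here: k + b_k \<le> f + b_f turns congruence modulo the
      modulus of D into congruence modulo that of A, so translation by w / z maps A to
      itself.\<close>
    hence ij: "[j - i = 0] (mod int p ^ (k + b k))"
      using admissible_mono[OF b True f(2)]
      by (meson cong_diff_iff_cong_0 cong_dvd_modulus cong_sym le_imp_power_dvd)
    define h where "h = x powi (j - i)"
    have h: "h \<noteq> 0" "w = z * h" by (simp_all add: h_def i j power_int_diff)
    have mem: "a * h \<in> A \<longleftrightarrow> a \<in> A" if "a \<in> mu (p ^ n)" for a
    proof -
      obtain m where m: "a = x powi m" using \<open>a \<in> mu (p ^ n)\<close> by (rule mu_powiE)
      have "[m + (j - i) = m] (mod int p ^ (k + b k))" using cong_add[OF cong_refl ij, of m] by simp
      moreover have "a * h = x powi (m + (j - i))" by (simp add: m h_def power_int_add)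
      ultimately show ?thesis
        unfolding A m by (simp only: powi_in_coset_iff[OF kb] cong_def)
    qed
    have G: "A \<subseteq> mu (p ^ n)" "h \<in> mu (p ^ n)" unfolding A h_def by (rule coset_subset powi_in_mu)+
    show ?thesis
    proof (rule sum.reindex_bij_witness[where i = "\<lambda>a. a / h" and j = "\<lambda>a. a * h"])
      fix a assume a: "a \<in> A"
      show "a * h \<in> A" using a G mem by blast
      have "a / h \<in> mu (p ^ n)" using a G mu_divide by blast
      thus "a / h \<in> A" using mem[of "a / h"] a h by simp
    qed (use h in auto)
  next
    case False
    have zero: "(\<Sum>a\<in>A. indicator B (y / a) :: int) = 0" if "y \<in> D" for y
    proof (rule sum.neutral, rule ballI)
      fix a assume a: "a \<in> A"
      obtain m where m: "a = x powi m" "[m = int p ^ k * u] (mod int p ^ (k + b k))"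
        using a unfolding A by (rule cosetE)
      show "(indicator B (y / a) :: int) = 0"
      proof (rule ccontr)
        assume "\<not> ?thesis"
        hence "y / a \<in> B" by (simp add: indicator_def)
        then obtain m' where m': "y / a = x powi m'" "[m' = int p ^ l * v] (mod int p ^ (l + b l))"
          unfolding B by (rule cosetE)
        have "y = x powi (m + m')" using m(1) m'(1) by (simp add: power_int_add field_simps)
        hence y: "[m + m' = int p ^ f * t] (mod int p ^ (f + b f))"
          using \<open>y \<in> D\<close> unfolding f using powi_in_coset_iff[OF admissible_bounds(1)[OF b f(2)]] by simp
        have "int p ^ k dvd m"
          using m(2) by (metis cong_dvd_iff cong_dvd_modulus dvd_triv_left le_add1 le_imp_power_dvd)
        moreover have "int p ^ l dvd m'"
          using m'(2) by (metis cong_dvd_iff cong_dvd_modulus dvd_triv_left le_add1 le_imp_power_dvd)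
        ultimately have "int p ^ k dvd m + m'"
          using kl by (meson dvd_add dvd_trans le_imp_power_dvd)
        moreover have "f < f + b f" "f < k" using False level_less[of f k] f kl by auto
        ultimately show False using level_not_dvd[OF y _ f(3)] by blast
      qed
    qed
    show ?thesis using zero z w by simp
  qed
qed

lemma fusion_partition_coset_family: "fusion_partition (mu (p ^ n)) (coset_family b)"
proof -
  note part = set_partition_coset_family
  note fin = finite_mu[OF order_pos]
  have sub: "D \<subseteq> mu (p ^ n)" if "D \<in> coset_family b" for D
    using part that by (simp add: set_partition_of_def)
  have U: "\<Union> (coset_family b) = mu (p ^ n)" using part by (simp add: set_partition_of_def)
  have "coset (int p ^ n * 1) (n + b n) \<in> coset_family b" unfolding coset_family_def by fastforce
  moreover have "coset (int p ^ n * 1) (n + b n) = {1}"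
    using powi_eq_iff[of "int p ^ n" 0]
    by (simp add: admissible_bounds(3)[OF b] coset_order cong_def)
  ultimately have one: "{1} \<in> coset_family b" by simp
  have "in_zspan (coset_family b) (gconv (mu (p ^ n)) (indicator A) (indicator B))"
    if A: "A \<in> coset_family b" and B: "B \<in> coset_family b" for A B
    unfolding in_zspan_iff[OF part fin] class_function_def U
  proof (intro conjI ballI allI impI)
    fix z assume "z \<notin> mu (p ^ n)"
    thus "gconv (mu (p ^ n)) (indicator A) (indicator B) z = 0"
      by (simp add: gconv_indicator[OF order_pos sub[OF A]])
  next
    fix D z w assume D: "D \<in> coset_family b" "z \<in> D" "w \<in> D"
    hence zw: "z \<in> mu (p ^ n)" "w \<in> mu (p ^ n)" using sub by auto
    obtain k u where k: "A = coset (int p ^ k * u) (k + b k)" "k \<le> n"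
      using A by (rule coset_familyE)
    obtain l v where l: "B = coset (int p ^ l * v) (l + b l)" "l \<le> n"
      using B by (rule coset_familyE)
    show "gconv (mu (p ^ n)) (indicator A) (indicator B) z =
        gconv (mu (p ^ n)) (indicator A) (indicator B) w"
    \<comment> \<open>Commutativity allows the sum to run over the factor of smaller level, whose
      stabiliser is the larger one.\<close>
    proof (cases "k \<le> l")
      case True
      thus ?thesis
        using product_constant_on_members[OF k(1) l(1) _ l(2) D] zw
        by (simp add: gconv_indicator[OF order_pos sub[OF A]])
    next
      case False
      thus ?thesis
        unfolding gconv_commute[of _ "indicator A"]
        using product_constant_on_members[OF l(1) k(1) _ k(2) D] zw
        by (simp add: gconv_indicator[OF order_pos sub[OF B]])
    qed
  qed
  hence unital: "unital_partition (mu (p ^ n)) (coset_family b)"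
    unfolding unital_partition_def using part one by blast
  have inv: "\<forall>A\<in>coset_family b. inverse ` A \<in> coset_family b"
  proof
    fix A assume "A \<in> coset_family b"
    then obtain k u where k: "A = coset (int p ^ k * u) (k + b k)" "k \<le> n" "coprime u (int p)"
      by (rule coset_familyE)
    have "inverse ` A = coset (int p ^ k * (- u)) (k + b k)"
    proof (intro equalityI subsetI)
      fix z assume "z \<in> inverse ` A"
      then obtain m where "z = inverse (x powi m)" "[m = int p ^ k * u] (mod int p ^ (k + b k))"
        unfolding k by (auto elim: cosetE)
      hence "z = x powi (- m)" "[- m = int p ^ k * (- u)] (mod int p ^ (k + b k))"
        by (simp_all add: power_int_minus cong_minus_minus_iff)
      thus "z \<in> coset (int p ^ k * (- u)) (k + b k)" by (auto simp: coset_def)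
    next
      fix z assume "z \<in> coset (int p ^ k * (- u)) (k + b k)"
      then obtain m where m: "z = x powi m" "[m = int p ^ k * (- u)] (mod int p ^ (k + b k))"
        by (rule cosetE)
      hence "[- m = int p ^ k * u] (mod int p ^ (k + b k))"
        using cong_minus_minus_iff[of m "int p ^ k * (- u)"] by simp
      hence "x powi (- m) \<in> A" unfolding k by (auto simp: coset_def)
      moreover have "z = inverse (x powi (- m))" by (simp add: m power_int_minus)
      ultimately show "z \<in> inverse ` A" by blast
    qed
    moreover have "coprime (- u) (int p)" using k by simp
    ultimately show "inverse ` A \<in> coset_family b" using k unfolding coset_family_def by blast
  qed
  show ?thesis
    unfolding fusion_partition_def
    using unital inv structure_constants_symmetric[OF order_pos part inv] by blast
qed

end

end

section \<open>Every such partition is a coset family\<close>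

lemma unit_generator_of_primroot:
  assumes g: "residue_primroot M g" and M: "M > 1"
  shows "unit_generator M (int g)"
  unfolding unit_generator_def
proof (intro conjI allI impI)
  show "coprime (int g) (int M)" using g by (auto simp: residue_primroot_def coprime_commute)
  fix y :: int assume y: "coprime y (int M)"
  define y' where "y' = nat (y mod int M)"
  have y': "int y' = y mod int M" using M by (simp add: y'_def)
  have "coprime (int y') (int M)"
    using cong_imp_coprime[OF _ y, of "int y'"] by (simp add: y' cong_def)
  hence cop: "coprime y' M" by simp
  have "y' \<noteq> 0" using cop M by (intro notI) simp
  moreover have "y' \<le> M" using M y' by (metis of_nat_0_less_iff of_nat_le_iff order_less_imp_le
        pos_mod_bound less_trans zero_less_one)
  ultimately have "y' \<in> totatives M" using cop by (simp add: totatives_def)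
  hence "y' \<in> (\<lambda>i. g ^ i mod M) ` {..<totient M}"
    using residue_primroot_is_generator[OF M g] by (simp add: bij_betw_def)
  then obtain i where "y' = g ^ i mod M" by auto
  hence "int g ^ i mod int M = y mod int M" using y' by (simp add: zmod_int)
  thus "\<exists>j. [int g ^ j = y] (mod int M)" by (auto simp: cong_def)
qed

lemma eq_prime_powerI:
  assumes p: "prime (p::nat)" and q: "q > 0" and r: "\<And>r. prime r \<Longrightarrow> r dvd q \<Longrightarrow> r = p"
  obtains s where "q = p ^ s"
proof -
  obtain q' where q': "q = p ^ multiplicity p q * q'" "\<not> p dvd q'"
    using multiplicity_decompose'[of q p] p q by (metis not_gr_zero not_prime_unit)
  have "q' = 1"
  proof (rule ccontr)
    assume "q' \<noteq> 1"
    then obtain r where "prime r" "r dvd q'" using prime_factor_nat by blast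
    thus False using r[of r] q' by (metis dvd_mult)
  qed
  thus thesis using that q' by simp
qed

section \<open>Conjugates of a member under powers of a primitive root\<close>

locale p_unital_partition = cyclic_p_group +
  fixes P :: "complex set set" and g :: nat
  assumes unital: "unital_partition (mu (p ^ n)) P" and cond_p: "cond_p p P"
    and primroot: "residue_primroot (p ^ n) g"
begin

lemma partition: "set_partition_of (mu (p ^ n)) P"
  using unital by (simp add: unital_partition_def)

lemma member_subset: "A \<in> P \<Longrightarrow> A \<subseteq> mu (p ^ n)"
  using partition by (simp add: set_partition_of_def)

lemma member_nonempty: "A \<in> P \<Longrightarrow> A \<noteq> {}"
  using partition by (simp add: set_partition_of_def)

lemma member_finite: "A \<in> P \<Longrightarrow> finite A"
  using member_subset finite_mu[OF order_pos] finite_subset by blast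

lemma member_eq: "A \<in> P \<Longrightarrow> B \<in> P \<Longrightarrow> z \<in> A \<Longrightarrow> z \<in> B \<Longrightarrow> A = B"
  using partition unfolding set_partition_of_def by blast

lemma member_exists:
  assumes "z \<in> mu (p ^ n)"
  obtains A where "A \<in> P" "z \<in> A"
  using assms partition unfolding set_partition_of_def by blast

lemma one_member: "{1} \<in> P"
  using unital by (simp add: unital_partition_def)

lemma generator_g: "unit_generator (p ^ n) (int g)"
  using unit_generator_of_primroot[OF primroot order_gt_1] .

lemma coprime_g: "coprime g p"
  using generator_g n_pos by (simp add: unit_generator_def)

lemma g_power_cong_iff:
  assumes "1 \<le> c" "c \<le> n"
  shows "[int g ^ i = int g ^ j] (mod int p ^ c) \<longleftrightarrow> [i = j] (mod totient (p ^ c))"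
  using unit_generator_power_cong_iff[OF unit_generator_power[OF generator_g assms], of i j]
    one_less_power[OF p_gt_1, of c] assms by simp

text \<open>The units modulo p^n are the powers of g, so these are the images of A under all
  automorphisms of the cyclic group, indexed additively.\<close>

definition conj_by :: "nat \<Rightarrow> complex set \<Rightarrow> complex set" where
  "conj_by i A = (\<lambda>z. z ^ (g ^ i)) ` A"

lemma conj_by_member: "A \<in> P \<Longrightarrow> conj_by i A \<in> P"
  unfolding conj_by_def
  using schur_multiplier[OF order_pos unital, of A "g ^ i"] coprime_g p_gt_1
  by (cases "g = 0") simp_all

lemma conj_by_add: "conj_by (i + j) A = conj_by i (conj_by j A)"
  by (simp add: conj_by_def image_image power_add power_mult[symmetric] mult.commute)

lemma inj_conj: "inj_on (\<lambda>z. z ^ (g ^ i)) (mu (p ^ n))"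
  using coprime_g by (intro mu_power_inj) simp

lemma conj_by_inj:
  "A \<subseteq> mu (p ^ n) \<Longrightarrow> B \<subseteq> mu (p ^ n) \<Longrightarrow> conj_by i A = conj_by i B \<longleftrightarrow> A = B"
  unfolding conj_by_def by (rule inj_on_image_eq_iff[OF inj_conj])

lemma card_conj_by: "A \<subseteq> mu (p ^ n) \<Longrightarrow> card (conj_by i A) = card A"
  unfolding conj_by_def by (rule card_image[OF inj_on_subset[OF inj_conj]])

lemma powi_power: "(x powi m) ^ (g ^ i) = x powi (m * int g ^ i)"
  by (simp add: power_int_power')

lemma power_totient:
  assumes "z \<in> mu (p ^ n)"
  shows "z ^ (g ^ totient (p ^ n)) = z"
proof -
  have "[g ^ totient (p ^ n) = 1] (mod p ^ n)"
    using coprime_g by (intro euler_theorem) simp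
  from mu_power_cong[OF assms this] show ?thesis by simp
qed

text \<open>Euler's theorem supplies a positive i that stabilises A. The least one, u, divides all
  others, because conjugation is injective on subsets of the group; A has exactly u
  conjugates.\<close>

lemma stabiliser_period:
  assumes A: "A \<in> P"
  obtains u where "0 < u" "\<And>i j. conj_by i A = conj_by j A \<longleftrightarrow> [i = j] (mod u)"
proof -
  define u where "u = (LEAST i. 0 < i \<and> conj_by i A = A)"
  have "conj_by (totient (p ^ n)) A = A"
    unfolding conj_by_def using power_totient member_subset[OF A] by (force simp: image_iff)
  moreover have "0 < totient (p ^ n)" using order_pos by simp
  ultimately have u: "0 < u" "conj_by u A = A"
    unfolding u_def by (metis (mono_tags, lifting) LeastI)+
  have least: "u \<le> i" if "0 < i" "conj_by i A = A" for i
    unfolding u_def using that by (intro Least_le) simp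
  have mult: "conj_by (u * t) A = A" for t
  proof (induction t)
    case 0
    show ?case by (simp add: conj_by_def)
  next
    case (Suc t)
    thus ?case using u(2) by (simp add: conj_by_add)
  qed
  have red: "conj_by i A = conj_by (i mod u) A" for i
  proof -
    have "conj_by (i mod u + u * (i div u)) A = conj_by (i mod u) A"
      by (simp only: conj_by_add mult)
    thus ?thesis by simp
  qed
  have inj: "i = j" if "i \<le> j" "j < u" "conj_by i A = conj_by j A" for i j
  proof (rule ccontr)
    assume "i \<noteq> j"
    have "conj_by i A = conj_by i (conj_by (j - i) A)"
      using that by (simp flip: conj_by_add)
    hence "conj_by (j - i) A = A"
      using conj_by_inj member_subset conj_by_member A by metis
    thus False using least[of "j - i"] \<open>i \<noteq> j\<close> that by simp
  qed
  have "conj_by i A = conj_by j A \<longleftrightarrow> [i = j] (mod u)" for i j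
  proof
    assume "conj_by i A = conj_by j A"
    hence "conj_by (i mod u) A = conj_by (j mod u) A" using red by simp
    thus "[i = j] (mod u)"
      unfolding cong_def using inj u(1) by (metis mod_less_divisor nle_le)
  qed (metis cong_def red)
  thus thesis using that u by blast
qed

text \<open>An element of prime order \<open>r \<noteq> p\<close> in the stabiliser of \<open>A\<close> would act on \<open>A\<close> without
  fixed points, making \<open>card A\<close> divisible by \<open>r\<close>.\<close>

lemma stabiliser_period_totient:
  assumes A: "A \<in> P" "A \<noteq> {1}" and u: "\<And>i j. conj_by i A = conj_by j A \<longleftrightarrow> [i = j] (mod u)"
  obtains b where "1 \<le> b" "b \<le> n" "u = totient (p ^ b)"
proof -
  let ?\<phi> = "totient (p ^ n)"
  have phi: "?\<phi> = p ^ (n - 1) * (p - 1)"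
    using n_pos by (simp add: totient_prime_power[OF prime_p])
  have id: "conj_by 0 A = A" by (simp add: conj_by_def)
  have "conj_by ?\<phi> A = A"
    unfolding conj_by_def using power_totient member_subset[OF A(1)] by (force simp: image_iff)
  hence "u dvd ?\<phi>" using u[of ?\<phi> 0] id by (simp add: cong_0_iff)
  then obtain q where q: "?\<phi> = u * q" by auto
  have "?\<phi> > 0" using order_pos by simp
  hence q0: "q > 0" and u0: "u > 0" using q by auto
  have "r = p" if r: "prime r" "r dvd q" for r
  proof (rule ccontr)
    assume rp: "r \<noteq> p"
    obtain q' where q': "q = r * q'" using r by auto
    \<comment> \<open>Here d is phi(p^n)/r and a multiple of the period u: g^d stabilises A, and its
      r-th power is 1 modulo p^n.\<close>
    define d where "d = u * q'"
    have d: "?\<phi> = d * r" using q q' by (simp add: d_def)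
    have stab: "conj_by d A = A" using u[of d 0] id by (simp add: d_def cong_0_iff)
    let ?f = "\<lambda>z::complex. z ^ (g ^ d)"
    have iter: "(?f ^^ t) z = z ^ (g ^ (d * t))" for t z
      by (induction t) (simp_all add: power_add power_mult[symmetric] mult.commute)
    have "[card A = card {z \<in> A. ?f z = z}] (mod r)"
    proof (rule card_cong_card_fixed_points[OF member_finite[OF A(1)] r(1)])
      show "?f ` A \<subseteq> A" using stab by (simp add: conj_by_def)
      show "(?f ^^ r) z = z" if "z \<in> A" for z
        using power_totient that member_subset[OF A(1)] unfolding iter d[symmetric] by blast
    qed
    moreover have "{z \<in> A. ?f z = z} = {}"
    proof (rule ccontr)
      assume "\<not> ?thesis"
      then obtain z where z: "z \<in> A" "?f z = z" by auto
      obtain m where m: "z = x powi m" using member_subset[OF A(1)] z mu_powiE by blast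
      have "z \<noteq> 1" using A z member_eq[OF A(1) one_member z(1)] by auto
      hence m0: "\<not> int p ^ n dvd m"
        using powi_eq_iff[of m 0] by (auto simp: m cong_0_iff)
      have "[m * int g ^ d = m] (mod int (p ^ n))"
        using z(2) unfolding m powi_power powi_eq_iff .
      hence dvd: "int p ^ n dvd m * (int g ^ d - 1)"
        by (simp add: cong_iff_dvd_diff algebra_simps)
      \<comment> \<open>Were g^d - 1 prime to p, the fixed point would be 1. But g^d = 1 modulo p
        makes p - 1 divide d = p^(n-1) * s with s = (p - 1)/r, hence divide s, which is
        smaller.\<close>
      have "int p dvd int g ^ d - 1"
      proof (rule ccontr)
        assume "\<not> int p dvd int g ^ d - 1"
        hence "coprime (int p ^ n) (int g ^ d - 1)"
          using prime_imp_coprime[OF prime_int_p] by simp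
        thus False using dvd m0 by (simp add: coprime_dvd_mult_left_iff)
      qed
      hence "[d = 0] (mod totient p)"
        using g_power_cong_iff[of 1 d 0] n_pos by (simp add: cong_iff_dvd_diff)
      hence dvd_d: "p - 1 dvd d" using prime_p by (simp add: totient_prime cong_0_iff)
      have "r dvd p ^ (n - 1) * (p - 1)" using d phi by (metis dvd_triv_right)
      hence "r dvd p - 1"
        using r rp prime_p by (metis prime_dvd_mult_iff prime_dvd_power primes_dvd_imp_eq)
      then obtain s where s: "p - 1 = r * s" by auto
      have s0: "s > 0" using s p_gt_1 by (cases s) auto
      have "d * r = p ^ (n - 1) * (p - 1)" using d phi by (rule trans[OF sym])
      also have "\<dots> = (p ^ (n - 1) * s) * r" by (simp only: s mult_ac)
      finally have "d = p ^ (n - 1) * s"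
        using prime_gt_0_nat[OF r(1)] by (metis mult_right_cancel less_not_refl)
      hence "p - 1 dvd p ^ (n - 1) * s" using dvd_d by simp
      moreover have "coprime (p - 1) (p ^ (n - 1))"
        using p_gt_1 coprime_diff_one_left_nat[of p] by simp
      ultimately have "p - 1 dvd s" using coprime_dvd_mult_right_iff by blast
      hence "p - 1 \<le> s" using s0 by (simp add: dvd_imp_le)
      thus False using s s0 prime_gt_1_nat[OF r(1)] by simp
    qed
    ultimately have "r dvd card A" by (simp add: cong_0_iff)
    moreover obtain e where "card A = p ^ e" using cond_p A(1) by (auto simp: cond_p_def)
    ultimately show False using rp r prime_p by (metis prime_dvd_power primes_dvd_imp_eq)
  qed
  then obtain s where s: "q = p ^ s" using eq_prime_powerI[OF prime_p q0] by blast
  \<comment> \<open>The factor p - 1 of phi(p^n) cannot absorb any of p^s, so s \<le> n - 1. This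
    makes b = n - s at least 1.\<close>
  have "coprime (p ^ s) (p - 1)" using p_gt_1 coprime_diff_one_right_nat[of p] by simp
  moreover have "p ^ s dvd p ^ (n - 1) * (p - 1)" using q s phi by simp
  ultimately have "p ^ s dvd p ^ (n - 1)" by (simp add: coprime_dvd_mult_left_iff)
  hence sn: "s \<le> n - 1" using p_gt_1 by (simp add: power_dvd_imp_le)
  hence ns: "1 \<le> n - s" "n - s \<le> n" "n - (n - s) = s" using n_pos by auto
  have "totient (p ^ n) = totient (p ^ (n - s)) * p ^ s"
    using totient_power_mult[OF ns(1,2)] unfolding ns(3) .
  moreover have "totient (p ^ n) = u * p ^ s" using q unfolding s .
  ultimately have "u * p ^ s = totient (p ^ (n - s)) * p ^ s" by (rule trans[OF sym, rotated])
  hence "u = totient (p ^ (n - s))" using p_gt_1 by simp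
  thus thesis using that ns by blast
qed

section \<open>From orbits of the stabiliser to cosets\<close>

lemma mult_power_of_g:
  assumes "coprime v (int p)" "coprime w (int p)"
  obtains i where "[w = v * int g ^ i] (mod int p ^ n)"
proof -
  have "coprime v (int p ^ n)" using assms by simp
  then obtain v' where v': "[v * v' = 1] (mod int p ^ n)" using cong_solve_coprime_int by blast
  hence "coprime (v * v') (int p ^ n)" using cong_imp_coprime cong_sym coprime_1_left by blast
  hence "coprime (v' * w) (int (p ^ n))" using assms by simp
  then obtain i where i: "[int g ^ i = v' * w] (mod int (p ^ n))"
    using generator_g unfolding unit_generator_def by blast
  have "[v * int g ^ i = v * (v' * w)] (mod int p ^ n)"
    using cong_scalar_left[OF i] by simp
  moreover have "[(v * v') * w = 1 * w] (mod int p ^ n)" using v' by (rule cong_scalar_right)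
  ultimately have "[v * int g ^ i = w] (mod int p ^ n)"
    using cong_trans by (simp add: mult.assoc) blast
  thus thesis using that cong_sym by blast
qed

text \<open>Units act transitively on the elements of one level. The congruence between the unit
  parts is returned as well, because \<open>member_is_coset\<close> reduces it modulo p^b.\<close>

lemma same_level_power:
  assumes "coprime v (int p)" "coprime w (int p)"
  obtains i where "x powi (int p ^ k * w) = (x powi (int p ^ k * v)) ^ (g ^ i)"
    "[w = v * int g ^ i] (mod int p ^ n)"
proof -
  obtain i where i: "[w = v * int g ^ i] (mod int p ^ n)" using mult_power_of_g[OF assms] .
  have "[int p ^ k * w = int p ^ k * v * int g ^ i] (mod int (p ^ n))"
    using cong_scalar_left[OF i, of "int p ^ k"] by (simp add: mult.assoc)
  hence "x powi (int p ^ k * w) = (x powi (int p ^ k * v)) ^ (g ^ i)"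
    unfolding powi_power powi_eq_iff .
  thus thesis using that i by blast
qed

text \<open>With \<open>k\<close> the lowest level met by \<open>A\<close>, the union \<open>T\<close> of the conjugates of \<open>A\<close> contains all of
  level \<open>k\<close> and has \<open>(p - 1) * p ^ (b - 1 + e)\<close> elements; as \<open>T\<close> has fewer than \<open>p ^ (n - k)\<close>
  elements, it is exactly level \<open>k\<close>.\<close>

lemma member_is_coset:
  assumes A: "A \<in> P"
  obtains k v b where "A = coset (int p ^ k * v) (k + b)" "coprime v (int p)" "k + b \<le> n"
    "k < n \<Longrightarrow> 1 \<le> b"
proof (cases "A = {1}")
  case True
  have "coset (int p ^ n * 1) n = {1}"
    using powi_eq_iff[of "int p ^ n" 0] by (simp add: coset_order cong_0_iff)
  thus thesis using that[of n 1 0] True by simp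
next
  case False
  obtain u where u: "0 < u" "\<And>i j. conj_by i A = conj_by j A \<longleftrightarrow> [i = j] (mod u)"
    using stabiliser_period[OF A] by blast
  obtain b where b: "1 \<le> b" "b \<le> n" "u = totient (p ^ b)"
    using stabiliser_period_totient[OF A False u(2)] by blast
  obtain e where e: "card A = p ^ e" using cond_p A by (auto simp: cond_p_def)
  have not_one: "1 \<notin> A" using member_eq[OF A one_member] False by blast
  define meets where "meets k \<longleftrightarrow> k \<le> n \<and> (\<exists>v. coprime v (int p) \<and> x powi (int p ^ k * v) \<in> A)" for k
  define k where "k = (LEAST k. meets k)"
  have level: "\<exists>k v. meets k \<and> coprime v (int p) \<and> z = x powi (int p ^ k * v)" if "z \<in> A" for z
  proof -
    have "z \<in> mu (p ^ n)" using that member_subset[OF A] by blast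
    then obtain m where m: "z = x powi m" by (rule mu_powiE)
    obtain k v where kv: "k \<le> n" "coprime v (int p)" "[m = int p ^ k * v] (mod int p ^ n)"
      by (rule level_decomposition)
    hence "z = x powi (int p ^ k * v)" by (simp add: m powi_eq_iff)
    thus ?thesis using kv that unfolding meets_def by blast
  qed
  hence "\<exists>k. meets k" using member_nonempty[OF A] by blast
  hence "meets k" unfolding k_def by (rule LeastI_ex)
  then obtain v where v: "k \<le> n" "coprime v (int p)" "x powi (int p ^ k * v) \<in> A"
    by (auto simp: meets_def)
  have least: "k \<le> l" if "meets l" for l unfolding k_def using that by (rule Least_le)
  have "k \<noteq> n"
  proof
    assume "k = n"
    hence "x powi (int p ^ k * v) = 1" using powi_eq_iff[of "int p ^ k * v" 0] by (simp add: cong_0_iff)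
    thus False using v not_one by simp
  qed
  hence kn: "k < n" using v by simp
  define T where "T = (\<Union>i<u. conj_by i A)"
  have "card T = (\<Sum>i<u. card (conj_by i A))"
    unfolding T_def
  proof (rule card_UN_disjoint)
    show "\<forall>i\<in>{..<u}. \<forall>j\<in>{..<u}. i \<noteq> j \<longrightarrow> conj_by i A \<inter> conj_by j A = {}"
    proof (intro ballI impI)
      fix i j assume "i \<in> {..<u}" "j \<in> {..<u}" "i \<noteq> j"
      hence "conj_by i A \<noteq> conj_by j A" using u(2) by (simp add: cong_def)
      thus "conj_by i A \<inter> conj_by j A = {}"
        using member_eq[OF conj_by_member[OF A] conj_by_member[OF A]] by blast
    qed
  qed (use member_finite conj_by_member A in auto)
  hence card_T: "card T = u * p ^ e" by (simp add: card_conj_by[OF member_subset[OF A]] e)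
  \<comment> \<open>Level k: the elements whose exponent is divisible by p^k and not by
    p^(k+1).\<close>
  define L where "L = coset 0 k - coset 0 (Suc k)"
  have sub_Suc: "coset 0 (Suc k) \<subseteq> coset 0 k"
    unfolding coset_def by (auto simp: cong_0_iff dest: dvd_mult_right)
  have card_L: "card L = p ^ (n - k - 1) * (p - 1)"
  proof -
    have "card L = p ^ (n - k) - p ^ (n - Suc k)"
      unfolding L_def using sub_Suc kn card_coset[of k 0] card_coset[of "Suc k" 0]
        finite_subset[OF coset_subset finite_mu[OF order_pos]]
      by (subst card_Diff_subset) auto
    moreover have "n - k = Suc (n - k - 1)" using kn by simp
    ultimately show ?thesis by (simp add: diff_mult_distrib mult.commute)
  qed
  have "L \<subseteq> T"
  proof
    fix z assume z: "z \<in> L"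
    then obtain m where m: "z = x powi m" "int p ^ k dvd m"
      unfolding L_def by (auto elim!: cosetE simp: cong_0_iff)
    then obtain w where w: "m = int p ^ k * w" by auto
    have "\<not> int p ^ Suc k dvd m"
      using z m kn unfolding L_def by (auto simp: powi_in_coset_iff cong_0_iff)
    hence "\<not> int p dvd w" unfolding w by (auto simp: mult_dvd_mono mult.commute)
    hence "coprime w (int p)"
      using prime_imp_coprime[OF prime_int_p] by (simp add: coprime_commute)
    then obtain i where "z = (x powi (int p ^ k * v)) ^ (g ^ i)"
      unfolding m w using same_level_power[OF v(2)] by metis
    hence "z \<in> conj_by i A" unfolding conj_by_def using v by blast
    also have "conj_by i A = conj_by (i mod u) A" using u(2) by (simp add: cong_def)
    finally show "z \<in> T" unfolding T_def using u(1) by auto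
  qed
  have T_sub: "T \<subseteq> coset 0 k - {1}"
  proof
    fix z assume "z \<in> T"
    then obtain i where i: "z \<in> conj_by i A" by (auto simp: T_def)
    then obtain y where y: "y \<in> A" "z = y ^ (g ^ i)" by (auto simp: conj_by_def)
    obtain l w where l: "meets l" "y = x powi (int p ^ l * w)" using level[OF y(1)] by blast
    have "int p ^ k dvd int p ^ l * w * int g ^ i"
      using least[OF l(1)] by (simp add: le_imp_power_dvd dvd_mult2)
    hence "z \<in> coset 0 k" unfolding y l powi_power coset_def by (auto simp: cong_0_iff)
    moreover have "z \<noteq> 1"
    proof
      assume "z = 1"
      hence "y = 1" using inj_onD[OF inj_conj[of i], of y 1] y member_subset[OF A] by auto
      thus False using y not_one by simp
    qed
    ultimately show "z \<in> coset 0 k - {1}" by simp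
  qed
  have fin_coset: "finite (coset 0 k)"
    using finite_subset[OF coset_subset finite_mu[OF order_pos]] .
  have fin_T: "finite T" using T_sub fin_coset finite_subset by blast
  have "1 \<in> coset 0 k" unfolding coset_def by (auto intro: exI[of _ 0])
  hence "T \<subset> coset 0 k" using T_sub by auto
  hence "u * p ^ e < p ^ (n - k)"
    using psubset_card_mono[OF fin_coset] card_T card_coset[OF v(1)] by metis
  moreover have u_val: "u = p ^ (b - 1) * (p - 1)" using b by (simp add: totient_prime_power[OF prime_p])
  ultimately have "p ^ (b - 1 + e) * (p - 1) < p ^ (n - k)" by (simp add: power_add mult_ac)
  \<comment> \<open>Dropping the factor p - 1 leaves a comparison of powers of p, giving b - 1 + e <
    n - k. The inclusion of L in T gives b - 1 + e \<ge> n - k - 1, so only equality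
    remains.\<close>
  moreover have "p ^ (b - 1 + e) * 1 \<le> p ^ (b - 1 + e) * (p - 1)"
    using p_gt_1 by (intro mult_le_mono2) simp
  ultimately have "p ^ (b - 1 + e) < p ^ (n - k)" by linarith
  hence up: "b - 1 + e < n - k" using p_gt_1 by (simp add: power_strict_increasing_iff)
  have u_eq: "u * p ^ e = p ^ (b - 1 + e) * (p - 1)"
    by (simp only: u_val power_add mult_ac)
  have "p ^ (n - k - 1) * (p - 1) \<le> p ^ (b - 1 + e) * (p - 1)"
    using card_mono[OF fin_T \<open>L \<subseteq> T\<close>] unfolding card_L card_T u_eq .
  hence "p ^ (n - k - 1) \<le> p ^ (b - 1 + e)" using p_gt_1 by simp
  hence "n - k - 1 \<le> b - 1 + e" using p_gt_1 by (simp add: power_increasing_iff)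
  hence eq: "n - k - 1 = b - 1 + e" using up kn by linarith
  have "L = T" using card_subset_eq[OF fin_T \<open>L \<subseteq> T\<close>] card_L card_T u_eq eq by simp
  have kb: "k + b \<le> n" "e = n - (k + b)" using eq kn b(1) by linarith+
  \<comment> \<open>Any z in A is the image of the base point under some g^i. Then the i-th
    conjugate of A meets A and equals it, so phi(p^b) divides i and g^i = 1 modulo p^b. Equal
    cardinalities turn the inclusion into equality.\<close>
  have "A \<subseteq> coset (int p ^ k * v) (k + b)"
  proof
    fix z assume z: "z \<in> A"
    have "conj_by 0 A = A" by (simp add: conj_by_def)
    hence "z \<in> L" using z u(1) unfolding \<open>L = T\<close> T_def by blast
    obtain l w where l: "meets l" "coprime w (int p)" "z = x powi (int p ^ l * w)"
      using level[OF z] by blast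
    have "l = k"
    proof (rule ccontr)
      assume "l \<noteq> k"
      hence "Suc k \<le> l" using least[OF l(1)] by simp
      hence "int p ^ Suc k dvd int p ^ l * w" by (meson dvd_mult2 le_imp_power_dvd)
      hence "z \<in> coset 0 (Suc k)" unfolding l(3) coset_def by (auto simp: cong_0_iff)
      thus False using \<open>z \<in> L\<close> by (simp add: L_def)
    qed
    obtain i where i: "z = (x powi (int p ^ k * v)) ^ (g ^ i)" "[w = v * int g ^ i] (mod int p ^ n)"
      unfolding l(3) \<open>l = k\<close> using same_level_power[OF v(2) l(2)] by metis
    have "z \<in> conj_by i A" unfolding conj_by_def using i v by blast
    hence "conj_by i A = conj_by 0 A"
      using member_eq[OF conj_by_member[OF A] A _ z] \<open>conj_by 0 A = A\<close> by simp
    hence "[i = 0] (mod totient (p ^ b))" using u(2) b(3) by simp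
    hence "[int g ^ i = 1] (mod int p ^ b)" using g_power_cong_iff[OF b(1,2), of i 0] by simp
    hence "[v * int g ^ i = v * 1] (mod int p ^ b)" by (rule cong_scalar_left)
    moreover have "[w = v * int g ^ i] (mod int p ^ b)"
      using i(2) b(2) by (meson cong_dvd_modulus le_imp_power_dvd)
    ultimately have "[w = v] (mod int p ^ b)" using cong_trans by simp blast
    hence "[int p ^ k * w = int p ^ k * v] (mod int p ^ (k + b))" by (rule cong_power_mult)
    thus "z \<in> coset (int p ^ k * v) (k + b)" unfolding l(3) \<open>l = k\<close> coset_def by blast
  qed
  hence "A = coset (int p ^ k * v) (k + b)"
    using card_subset_eq[OF finite_subset[OF coset_subset finite_mu[OF order_pos]]]
      card_coset[OF kb(1)] e kb(2) by metis
  thus thesis using that v(2) kb(1) b(1) by blast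
qed

section \<open>Reading off the function b\<close>

lemma standard_member:
  assumes k: "k \<le> n"
  shows "\<exists>b. k + b \<le> n \<and> (k < n \<longrightarrow> 1 \<le> b) \<and> coset (int p ^ k) (k + b) \<in> P"
proof -
  obtain A where A: "A \<in> P" "x powi (int p ^ k) \<in> A" using member_exists[OF powi_in_mu] by blast
  obtain l v b where l: "A = coset (int p ^ l * v) (l + b)" "coprime v (int p)" "l + b \<le> n"
    "l < n \<Longrightarrow> 1 \<le> b" using member_is_coset[OF A(1)] by blast
  have cong: "[int p ^ k = int p ^ l * v] (mod int p ^ (l + b))"
    using A(2) unfolding l(1) powi_in_coset_iff[OF l(3)] .
  \<comment> \<open>Divisibility yields l \<le> k. Below level n one has b \<ge> 1, so the
    congruence also excludes l < k, and p^k itself represents the class.\<close>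
  have "int p ^ l dvd int p ^ k"
    using cong by (metis cong_dvd_iff cong_dvd_modulus dvd_triv_left le_add1 le_imp_power_dvd)
  hence "int (p ^ l) dvd int (p ^ k)" by simp
  hence "p ^ l dvd p ^ k" by (simp only: int_dvd_int_iff)
  hence "l \<le> k" using p_gt_1 by (simp add: power_dvd_imp_le)
  moreover have "\<not> l < k"
  proof
    assume "l < k"
    thus False using level_not_dvd[OF cong _ l(2), of k] l(4) k by auto
  qed
  ultimately have "k = l" by simp
  thus ?thesis using A(1) l(1,3,4) coset_cong[OF cong] by (intro exI[of _ b]) simp
qed

lemma conj_by_coset:
  assumes "c \<le> n"
  shows "conj_by i (coset j c) = coset (j * int g ^ i) c"
proof (rule card_subset_eq)
  show "finite (coset (j * int g ^ i) c)"
    using finite_subset[OF coset_subset finite_mu[OF order_pos]] .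
  show "conj_by i (coset j c) \<subseteq> coset (j * int g ^ i) c"
  proof
    fix z assume "z \<in> conj_by i (coset j c)"
    then obtain m where m: "z = (x powi m) ^ (g ^ i)" "[m = j] (mod int p ^ c)"
      unfolding conj_by_def by (auto elim: cosetE)
    thus "z \<in> coset (j * int g ^ i) c"
      using cong_scalar_right[OF m(2), of "int g ^ i"] unfolding powi_power coset_def by blast
  qed
  show "card (conj_by i (coset j c)) = card (coset (j * int g ^ i) c)"
    by (simp add: card_conj_by[OF coset_subset] card_coset[OF assms])
qed

lemma prod_list_coset:
  assumes c: "c \<le> n"
  shows "set xs \<subseteq> coset j c \<Longrightarrow> prod_list xs \<in> coset (int (length xs) * j) c"
proof (induction xs)
  case Nil
  show ?case by (auto simp: coset_def intro: exI[of _ 0])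
next
  case (Cons y ys)
  then obtain m where m: "prod_list ys = x powi m" "[m = int (length ys) * j] (mod int p ^ c)"
    by (auto elim: cosetE)
  obtain l where l: "y = x powi l" "[l = j] (mod int p ^ c)" using Cons.prems by (auto elim: cosetE)
  have "y * prod_list ys = x powi (l + m)" by (simp add: l m power_int_add)
  moreover have "[l + m = int (Suc (length ys)) * j] (mod int p ^ c)"
    using cong_add[OF l(2) m(2)] by (simp add: algebra_simps)
  ultimately show ?case unfolding prod_list.Cons coset_def list.size by auto
qed

text \<open>The \<open>p\<close>-fold products of elements of \<open>coset (p ^ k) c\<close> fill \<open>coset (p ^ Suc k) c\<close>, which must
  therefore contain the member through \<open>p ^ Suc k\<close>.\<close>

lemma standard_members_mono:
  assumes c: "coset (int p ^ k) c \<in> P" "c \<le> n" and d: "coset (int p ^ Suc k) d \<in> P" "d \<le> n"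
  shows "c \<le> d"
proof (rule ccontr)
  assume "\<not> c \<le> d"
  let ?A = "coset (int p ^ k) c"
  define z where "z = x powi (int p ^ Suc k)"
  \<comment> \<open>w lies in the member of z, but its exponent is off by p^d. If d < c, this is not
    a multiple of p^c, so w cannot be a p-fold product of elements of \<open>?A\<close>, whereas z
    is one.\<close>
  define w where "w = x powi (int p ^ Suc k + int p ^ d)"
  have "x powi (int p ^ k) \<in> ?A" by (auto simp: coset_def)
  moreover have "(x powi (int p ^ k)) ^ p = z"
    by (simp add: z_def power_int_power' mult.commute)
  ultimately have "replicate p (x powi (int p ^ k)) \<in> tuples ?A p z"
    by (auto simp: tuples_def)
  hence "card (tuples ?A p z) \<noteq> 0"
    using finite_tuples[OF member_finite[OF c(1)]] by auto
  moreover have "z \<in> coset (int p ^ Suc k) d" "w \<in> coset (int p ^ Suc k) d"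
    unfolding z_def w_def powi_in_coset_iff[OF d(2)] by (simp_all add: cong_def)
  hence "int (card (tuples ?A p w)) = int (card (tuples ?A p z))"
    using class_function_tuples[OF order_pos unital c(1), of p] d(1)
    unfolding class_function_def by blast
  ultimately have "tuples ?A p w \<noteq> {}" by auto
  then obtain xs where xs: "length xs = p" "set xs \<subseteq> ?A" "prod_list xs = w"
    by (auto simp: tuples_def)
  hence "w \<in> coset (int p * int p ^ k) c" using prod_list_coset[OF c(2) xs(2)] by simp
  hence "int p ^ c dvd int p ^ d"
    unfolding w_def powi_in_coset_iff[OF c(2)] by (simp add: cong_iff_dvd_diff)
  hence "int (p ^ c) dvd int (p ^ d)" by simp
  hence "p ^ c dvd p ^ d" by (simp only: int_dvd_int_iff)
  thus False using \<open>\<not> c \<le> d\<close> p_gt_1 by (simp add: power_dvd_imp_le)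
qed

theorem admissible_coset_family:
  obtains b where "admissible_b n b" "P = coset_family b"
proof -
  define b where "b k = (SOME b. k + b \<le> n \<and> (k < n \<longrightarrow> 1 \<le> b) \<and> coset (int p ^ k) (k + b) \<in> P)" for k
  have b: "k + b k \<le> n \<and> (k < n \<longrightarrow> 1 \<le> b k) \<and> coset (int p ^ k) (k + b k) \<in> P" if "k \<le> n" for k
    unfolding b_def using someI_ex[OF standard_member[OF that]] .
  \<comment> \<open>The bounds \<open>k + b k \<le> n\<close> and \<open>1 \<le> b k\<close> leave
    no choice at the two top levels.\<close>
  have "b n = 0" using b[of n] by simp
  moreover have "b (n - 1) = 1"
    using b[of "n - 1"] n_pos by auto
  moreover have "b k \<le> b (Suc k) + 1" if "k < n" for k
    using standard_members_mono[of k "k + b k" "Suc k + b (Suc k)"] b[of k] b[of "Suc k"] that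
    by auto
  ultimately have adm: "admissible_b n b" unfolding admissible_b_def using b by simp
  have mem: "coset (int p ^ k * v) (k + b k) \<in> P" if kv: "k \<le> n" "coprime v (int p)" for k v
  proof -
    obtain i where "[v = 1 * int g ^ i] (mod int p ^ n)"
      by (rule mult_power_of_g[OF coprime_1_left kv(2)])
    hence "[v = int g ^ i] (mod int p ^ n)" by simp
    hence "[int p ^ k * int g ^ i = int p ^ k * v] (mod int p ^ n)"
      by (rule cong_scalar_left[OF cong_sym])
    hence "[int p ^ k * int g ^ i = int p ^ k * v] (mod int p ^ (k + b k))"
      using b[OF kv(1)] by (meson cong_dvd_modulus le_imp_power_dvd)
    hence "conj_by i (coset (int p ^ k) (k + b k)) = coset (int p ^ k * v) (k + b k)"
      using conj_by_coset coset_cong b[OF kv(1)] by simp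
    thus ?thesis using conj_by_member b[OF kv(1)] by metis
  qed
  \<comment> \<open>Every set of the family is a member, and the family reaches every element of the
    group, so it misses no member.\<close>
  have "P = coset_family b"
  proof (intro equalityI subsetI)
    fix A assume A: "A \<in> P"
    then obtain z where z: "z \<in> A" using member_nonempty by blast
    obtain m where m: "z = x powi m" using z member_subset[OF A] mu_powiE by blast
    obtain k v where kv: "k \<le> n" "coprime v (int p)" "[m = int p ^ k * v] (mod int p ^ n)"
      by (rule level_decomposition)
    have "z = x powi (int p ^ k * v)" using kv by (simp add: m powi_eq_iff)
    hence "z \<in> coset (int p ^ k * v) (k + b k)" by (auto simp: coset_def)
    hence "A = coset (int p ^ k * v) (k + b k)"
      using member_eq[OF A mem[OF kv(1,2)] z] by simp
    thus "A \<in> coset_family b" using kv unfolding coset_family_def by blast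
  qed (auto simp: coset_family_def mem)
  thus thesis using that adm by blast
qed

end

lemma exists_generator:
  assumes "N > 0"
  obtains x where "is_generator N x"
proof
  let ?x = "cis (2 * pi / real N)"
  have pow: "?x ^ k = cis (2 * pi * real k / real N)" for k
    by (simp add: DeMoivre mult_ac)
  show "is_generator N ?x"
    unfolding is_generator_def
  proof (intro conjI ballI)
    show "?x \<in> mu N" unfolding mu_def using assms pow[of N] by simp
    fix z assume "z \<in> mu N"
    hence "z \<in> (\<lambda>k. cis (2 * pi * real k / real N)) ` {..<N}"
      using bij_betw_roots_unity[OF assms] by (simp add: mu_def bij_betw_def)
    thus "\<exists>j. z = ?x ^ j" unfolding pow by blast
  qed
qed

theorem theorem3p16:
  fixes p n :: nat
  assumes "prime p" and "odd p" and "1 \<le> n"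
  shows "(\<forall>b x \<alpha>. admissible_b n b \<and> is_generator (p ^ n) x \<and> unit_generator (p ^ n) \<alpha> \<longrightarrow>
            fusion_partition (mu (p ^ n)) (fusion_family p n b x \<alpha>) \<and>
            cond_p p (fusion_family p n b x \<alpha>))
       \<and> (\<forall>P. fusion_partition (mu (p ^ n)) P \<and> cond_p p P \<longrightarrow>
            (\<exists>b x \<alpha>. admissible_b n b \<and> is_generator (p ^ n) x \<and> unit_generator (p ^ n) \<alpha> \<and>
               P = fusion_family p n b x \<alpha>))"
proof (intro conjI allI impI)
  fix b x \<alpha>
  assume h: "admissible_b n b \<and> is_generator (p ^ n) x \<and> unit_generator (p ^ n) \<alpha>"
  interpret cyclic_p_group p n x using assms h by unfold_locales auto
  have "fusion_family p n b x \<alpha> = coset_family b"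
    using h admissible_bounds by (intro fusion_family_eq) auto
  moreover have "fusion_partition (mu (p ^ n)) (coset_family b)"
    using h fusion_partition_coset_family by blast
  moreover have "cond_p p (coset_family b)"
    using h admissible_bounds by (intro cond_p_coset_family) auto
  ultimately show "fusion_partition (mu (p ^ n)) (fusion_family p n b x \<alpha>)"
    and "cond_p p (fusion_family p n b x \<alpha>)" by simp_all
next
  fix P assume P: "fusion_partition (mu (p ^ n)) P \<and> cond_p p P"
  have "0 < p ^ n" using assms prime_gt_0_nat by simp
  then obtain x where x: "is_generator (p ^ n) x" by (rule exists_generator)
  \<comment> \<open>Oddness of p enters here: the unit group modulo p^n is cyclic. The same g
    defines the conjugation action and serves as \<alpha>.\<close>
  obtain g where g: "residue_primroot (p ^ n) g"
    using residue_primroot_odd_prime_power_exists[OF assms(1,2)] assms(3) by (metis less_le_trans zero_less_one)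
  interpret p_unital_partition p n x P g
    using assms x g P by unfold_locales (auto simp: fusion_partition_def)
  obtain b where b: "admissible_b n b" "P = coset_family b" by (rule admissible_coset_family)
  have "fusion_family p n b x (int g) = coset_family b"
    using admissible_bounds[OF b(1)] by (intro fusion_family_eq generator_g) auto
  thus "\<exists>b x \<alpha>. admissible_b n b \<and> is_generator (p ^ n) x \<and> unit_generator (p ^ n) \<alpha> \<and>
      P = fusion_family p n b x \<alpha>"
    using b x generator_g by metis
qed

end
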